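(* Let $p(n)$ denote the number of partitions of $n$. For all integers $n>6$, \[ \frac{p(n-1)}{p(n)}\left(1+\frac{240}{(24n)^{3/2}}\right) > \frac{p(n)}{p(n+1)}. \]
   Context: $p(n)$ is the partition function: the number of ways of writing $n$ as an unordered sum of positive integers. *)

theory Defs
  imports Complex_Main "HOL-Library.Multiset"
begin

definition partition_count :: "nat \<Rightarrow> nat" where
  "partition_count n = card {M :: nat multiset. (\<forall>k\<in>#M. 0 < k) \<and> sum_mset M = n}"

end

theory Submission
  imports Defs "HOL-Complex_Analysis.Complex_Analysis" "HOL-Probability.Distributions"
begin

text \<open>
  For \<open>n < 800\<close> the inequality is checked by computing the partition numbers with Euler's pentagonal
  recurrence. For \<open>n \<ge> 800\<close> only a crude form of the saddle point method is needed. Write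
  \<open>P(z) = \<Prod>\<^sub>j 1/(1 - z\<^sup>j) = exp (\<Sum>\<^sub>m z\<^sup>m / (m (1 - z\<^sup>m)))\<close> and choose \<open>t > 0\<close> such that
  \<open>h(\<theta>) = P(e\<^bsup>-t+i\<theta>\<^esup>) e\<^bsup>-in\<theta>\<^esup> / P(e\<^bsup>-t\<^esup>)\<close> has a stationary phase at \<open>\<theta> = 0\<close>. Put
  \<open>a = \<integral> Re h\<close>, \<open>C = \<integral> Re h cos \<theta>\<close> and \<open>S = \<integral> Im h sin \<theta>\<close>, the integrals extending over \<open>[0, \<pi>]\<close>.
  Up to a common factor \<open>p(n)\<^sup>2\<close> is \<open>a\<^sup>2\<close> and \<open>p(n-1) p(n+1)\<close> is \<open>(C - S)(C + S)\<close>, and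
  \<open>a\<^sup>2 - C\<^sup>2 + S\<^sup>2 \<le> (\<integral> |h|) (\<integral> |h| \<theta>\<^sup>2) + S\<^sup>2\<close>. If \<open>h\<close> were the Gaussian of variance \<open>1/\<sigma>\<^sup>2\<close>
  this would be \<open>a\<^sup>2/\<sigma>\<^sup>2\<close>, about a third of what the theorem permits, so rough bounds on \<open>|h|\<close> and
  on the phase of \<open>h\<close> suffice; both follow term by term from the series over \<open>m\<close>, without modularity.
\<close>

section \<open>Partitions and the pentagonal number theorem\<close>

text \<open>The budget: stationarity means that \<open>mean_size t\<close> equals n, and
  \<open>mean_size t\<close> is at most \<pi>^2 / (6 t^2). Hence (24 n)^(3/2) is at most 8 \<pi>^3 /
  t^3, and the theorem grants a relative excess of 240 t^3 / (8 \<pi>^3), a little more than 0.967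
  t^3. Near 0 the modulus of h is close to exp (- \<pi>^2 \<theta>^2 / (6 t^3)), a Gaussian of
  variance 3 t^3 / \<pi>^2, about 0.304 t^3.

  The obstacle is that the loss in log |h| is quadratic only while \<theta> is small against t; for
  larger angles it levels off at the order of 1 / t. The peak has width t^(3/2), so only a factor
  sqrt t, which decays as slowly as n^(-1/4), separates it from the region where a Gaussian
  comparison fails. The spare factor three pays for this: a Gaussian with a worse constant near 0
  and a step function beyond are good enough once t <= 1/22, and that puts the change to direct
  computation at 800.

  One t serves n - 1, n and n + 1, so the value of P at the saddle point cancels and no asymptotics
  of p(n) enter.\<close>

definition bounded_partitions :: "nat \<Rightarrow> nat \<Rightarrow> nat multiset set" where
  "bounded_partitions k n = {M. set_mset M \<subseteq> {1..k} \<and> sum_mset M = n}"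

lemma size_le_sum_mset:
  assumes "\<forall>x\<in>#M. 0 < (x::nat)"
  shows "size M \<le> sum_mset M"
  using assms by (induction M) auto

lemma finite_bounded_partitions: "finite (bounded_partitions k n)"
proof (rule finite_subset)
  show "bounded_partitions k n \<subseteq> (\<Union>i\<le>n. {M. set_mset M \<subseteq> {1..k} \<and> size M = i})"
  proof
    fix M assume M: "M \<in> bounded_partitions k n"
    then have "size M \<le> n"
      using size_le_sum_mset[of M] by (auto simp: bounded_partitions_def subset_iff Suc_le_eq)
    then show "M \<in> (\<Union>i\<le>n. {M. set_mset M \<subseteq> {1..k} \<and> size M = i})"
      using M by (auto simp: bounded_partitions_def)
  qed
  show "finite (\<Union>i\<le>n. {M. set_mset M \<subseteq> {1..k} \<and> size M = i})"
    using finite_multisets_of_size[of "{1..k}"] by (auto simp: multisets_of_size_def)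
qed

lemma member_le_sum_mset: "x \<in># M \<Longrightarrow> x \<le> sum_mset (M :: nat multiset)"
  by (auto dest!: multi_member_split)

lemma bounded_partitions_eq_all:
  assumes "n \<le> k"
  shows "bounded_partitions k n = {M. (\<forall>x\<in>#M. 0 < x) \<and> sum_mset M = n}"
proof -
  have "x \<le> k" if "x \<in># M" "sum_mset M = n" for x and M :: "nat multiset"
    using member_le_sum_mset[OF that(1)] that(2) assms by linarith
  then show ?thesis
    by (auto simp: bounded_partitions_def Suc_le_eq)
qed

lemma bounded_partitions_0: "bounded_partitions 0 n = (if n = 0 then {{#}} else {})"
  by (auto simp: bounded_partitions_def)

text \<open>Split by whether the part \<open>Suc k\<close> occurs; taking away one copy of it is a
  bijection.\<close>

lemma card_bounded_partitions_Suc: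
  "card (bounded_partitions (Suc k) n) = card (bounded_partitions k n) +
     (if Suc k \<le> n then card (bounded_partitions (Suc k) (n - Suc k)) else 0)"
proof -
  let ?A = "{M \<in> bounded_partitions (Suc k) n. Suc k \<in># M}"
  have "bounded_partitions k n = {M \<in> bounded_partitions (Suc k) n. Suc k \<notin># M}"
  proof -
    have "set_mset M \<subseteq> {1..k} \<longleftrightarrow> set_mset M \<subseteq> {1..Suc k} \<and> Suc k \<notin># M" for M
      by (auto simp: subset_iff le_Suc_eq)
    then show ?thesis
      unfolding bounded_partitions_def by blast
  qed
  then have "bounded_partitions (Suc k) n = bounded_partitions k n \<union> ?A"
    "bounded_partitions k n \<inter> ?A = {}" by auto
  then have 1: "card (bounded_partitions (Suc k) n) = card (bounded_partitions k n) + card ?A"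
    using finite_bounded_partitions[of k n] finite_bounded_partitions[of "Suc k" n]
    by (metis (no_types, lifting) card_Un_disjoint finite_Un)
  show ?thesis
  proof (cases "Suc k \<le> n")
    case True
    have "bij_betw (add_mset (Suc k)) (bounded_partitions (Suc k) (n - Suc k)) ?A"
    proof (intro bij_betw_byWitness[where f' = "\<lambda>M. M - {#Suc k#}"])
      show "(\<lambda>M. M - {#Suc k#}) ` ?A \<subseteq> bounded_partitions (Suc k) (n - Suc k)"
      proof
        fix N assume "N \<in> (\<lambda>M. M - {#Suc k#}) ` ?A"
        then obtain M where M: "M \<in> bounded_partitions (Suc k) n" "Suc k \<in># M" "N = M - {#Suc k#}"
          by blast
        then have "M = add_mset (Suc k) N" by simp
        then show "N \<in> bounded_partitions (Suc k) (n - Suc k)"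
          using M(1) by (auto simp: bounded_partitions_def)
      qed
    qed (use True in \<open>auto simp: bounded_partitions_def\<close>)
    then show ?thesis
      using 1 True by (simp add: bij_betw_same_card)
  next
    case False
    have "?A = {}"
    proof -
      have False if "sum_mset M = n" "Suc k \<in># M" for M :: "nat multiset"
        using member_le_sum_mset[OF that(2)] that(1) False by linarith
      then show ?thesis by (auto simp: bounded_partitions_def)
    qed
    then show ?thesis
      using 1 False by (simp only: card.empty if_False)
  qed
qed

text \<open>Bounding the parts makes the inverse series a finite product, and coefficients up to k
  are already the true partition numbers. The type is left open because the pentagonal recurrence
  needs integer coefficients and the circle integral complex ones.\<close>

definition partition_fps :: "nat \<Rightarrow> 'a :: comm_ring_1 fps" where
  "partition_fps k = Abs_fps (\<lambda>n. of_nat (card (bounded_partitions k n)))"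

lemma partition_fps_nth:
  "n \<le> k \<Longrightarrow> fps_nth (partition_fps k) n = of_nat (partition_count n)"
  by (simp add: partition_fps_def partition_count_def bounded_partitions_eq_all)

lemma partition_fps_Suc: "(1 - fps_X ^ Suc k) * partition_fps (Suc k) = partition_fps k"
proof (rule fps_ext)
  fix n
  have "(1 - fps_X ^ Suc k) * partition_fps (Suc k)
      = partition_fps (Suc k) - fps_X ^ Suc k * (partition_fps (Suc k) :: 'a fps)"
    by (simp add: algebra_simps)
  then show "fps_nth ((1 - fps_X ^ Suc k) * partition_fps (Suc k)) n = fps_nth (partition_fps k :: 'a fps) n"
    using card_bounded_partitions_Suc[of k n]
    by (simp add: partition_fps_def fps_X_power_mult_nth del: power_Suc)
qed

lemma prod_mult_partition_fps: "(\<Prod>j=1..k. 1 - fps_X ^ j) * partition_fps k = 1"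
proof (induction k)
  case 0
  show ?case
    by (rule fps_ext) (simp add: partition_fps_def bounded_partitions_0)
next
  case (Suc k)
  then show ?case
    by (simp add: prod.cl_ivl_Suc mult.assoc partition_fps_Suc del: power_Suc)
qed

section \<open>Euler's pentagonal number theorem\<close>

definition triangle :: "nat \<Rightarrow> nat" where "triangle s = (\<Sum>i\<le>s. i)"

lemma triangle_0 [simp]: "triangle 0 = 0"
  and triangle_Suc [simp]: "triangle (Suc s) = triangle s + Suc s"
  by (simp_all add: triangle_def)

text \<open>With k = s + 1 the exponents are the generalized pentagonal numbers k (3 k - 1) / 2 and
  k (3 k + 1) / 2.\<close>

definition pentagonal_pair :: "nat \<Rightarrow> int fps" where
  "pentagonal_pair s = (-1) ^ Suc s * (fps_X ^ (Suc s * Suc s + triangle s)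
     + fps_X ^ (Suc s * Suc s + triangle (Suc s)))"

text \<open>Shanks' finite form of Euler's pentagonal number theorem.\<close>

lemma shanks_identity:
  "(\<Sum>s\<le>n. (-1) ^ s * fps_X ^ (n * s + triangle s) * (\<Prod>j\<in>{s<..n}. 1 - fps_X ^ j))
     = 1 + (\<Sum>s<n. pentagonal_pair s)"
proof (induction n)
  case 0
  show ?case by simp
next
  case (Suc n)
  define Q :: "nat \<Rightarrow> int fps" where "Q s = (\<Prod>j\<in>{s<..n}. 1 - fps_X ^ j)" for s
  \<comment> \<open>\<open>T\<close> makes the induction telescope: the terms of index s for n + 1
    and for n differ by \<open>T (s - 1) - T s\<close>. What remains is the boundary term
    \<open>- T n\<close>, which together with the extra summand of index n + 1 is the new pentagonal
    pair.\<close>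
  define T where "T s = (-1) ^ s * fps_X ^ (Suc n * Suc s + triangle s) * Q s" for s
  have Q_Suc: "(1 - fps_X ^ Suc s) * Q (Suc s) = Q s" if "s < n" for s
  proof -
    have "{s<..n} = insert (Suc s) {Suc s<..n}" using that by auto
    then show ?thesis by (simp add: Q_def del: power_Suc)
  qed
  define f :: "nat \<Rightarrow> int fps" where
    "f s = (-1) ^ s * fps_X ^ (Suc n * s + triangle s) * (\<Prod>j\<in>{s<..Suc n}. 1 - fps_X ^ j)" for s
  define g where "g s = (-1) ^ s * fps_X ^ (n * s + triangle s) * Q s" for s
  have f: "f s = (-1) ^ s * fps_X ^ (Suc n * s + triangle s) * ((1 - fps_X ^ Suc n) * Q s)" if "s \<le> n" for s
  proof -
    have "{s<..Suc n} = insert (Suc n) {s<..n}" using that by auto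
    then show ?thesis by (simp add: f_def Q_def del: power_Suc)
  qed
  have f0: "f 0 - g 0 = - T 0"
    using f[of 0] by (simp add: g_def T_def algebra_simps)
  have fS: "f (Suc s) - g (Suc s) = T s - T (Suc s)" if "Suc s \<le> n" for s
  proof -
    have "T s = (-1) ^ s * fps_X ^ (n * Suc s + triangle (Suc s)) * ((1 - fps_X ^ Suc s) * Q (Suc s))"
    proof -
      have "Suc n * Suc s + triangle s = n * Suc s + triangle (Suc s)" by simp
      then show ?thesis using that by (simp only: Q_Suc T_def Suc_le_eq)
    qed
    then show ?thesis
      unfolding f[OF that] g_def T_def
      by (simp add: algebra_simps power_add)
  qed
  have "(\<Sum>s\<le>m. f s - g s) = - T m" if "m \<le> n" for m
    using that by (induction m) (simp_all add: f0 fS)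
  then have "(\<Sum>s\<le>n. f s) - (\<Sum>s\<le>n. g s) = - T n"
    by (simp add: sum_subtractf)
  moreover have "(\<Sum>s\<le>n. g s) = 1 + (\<Sum>s<n. pentagonal_pair s)"
    using Suc.IH by (simp add: g_def Q_def)
  moreover have "f (Suc n) - T n = pentagonal_pair n"
    by (simp add: f_def T_def Q_def pentagonal_pair_def algebra_simps)
  ultimately have "(\<Sum>s\<le>Suc n. f s) = 1 + (\<Sum>s<Suc n. pentagonal_pair s)"
    by (simp add: algebra_simps)
  then show ?case by (simp only: f_def)
qed

lemma fps_nth_X_power_mult_eq_0: "i < m \<Longrightarrow> fps_nth (fps_X ^ m * F) i = 0"
  by (simp add: fps_X_power_mult_nth)

text \<open>In Shanks' sum the term s = 0 is the Euler product itself, and every later term is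
  divisible by a power of X beyond degree n.\<close>

lemma euler_product_nth:
  assumes "i \<le> n"
  shows "fps_nth (\<Prod>j=1..n. 1 - fps_X ^ j) i = fps_nth (1 + (\<Sum>s<n. pentagonal_pair s)) i"
proof -
  have "fps_nth ((-1) ^ Suc s * fps_X ^ (n * Suc s + triangle (Suc s)) * (\<Prod>j\<in>{Suc s<..n}. 1 - fps_X ^ j)) i
      = (0::int)" for s
  proof -
    let ?m = "n * Suc s + triangle (Suc s)" and ?P = "\<Prod>j\<in>{Suc s<..n}. 1 - fps_X ^ j :: int fps"
    have "i < ?m" using assms by simp
    moreover have "(-1) ^ Suc s * fps_X ^ ?m * ?P = fps_X ^ ?m * ((-1) ^ Suc s * ?P)"
      by (simp only: ac_simps)
    ultimately show ?thesis
      by (simp only: fps_nth_X_power_mult_eq_0)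
  qed
  moreover have "{0<..n} = {1..n}" by auto
  ultimately show ?thesis
    unfolding shanks_identity[symmetric]
    by (simp add: sum.atMost_shift fps_sum_nth del: power_Suc triangle_Suc mult_Suc_right)
qed

lemma pentagonal_pair_nth_eq_0: "i < Suc s * Suc s \<Longrightarrow> fps_nth (pentagonal_pair s) i = 0"
proof -
  assume i: "i < Suc s * Suc s"
  have c: "(-1) ^ Suc s = fps_const ((-1) ^ Suc s :: int)"
    by (simp only: fps_const_power[symmetric] fps_const_neg[symmetric] fps_const_1_eq_1)
  show ?thesis
    using i unfolding pentagonal_pair_def c by (simp add: fps_X_power_nth del: power_Suc triangle_Suc)
qed

definition partition_gf :: "int fps" where
  "partition_gf = Abs_fps (\<lambda>n. int (partition_count n))"

text \<open>Coefficient n > 0 of the Euler product times its inverse vanishes. Dropping the pairs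
  from K on is harmless because \<open>pentagonal_pair s\<close> has no terms below degree (s +
  1)^2, a crude bound that keeps the side condition simple.\<close>

lemma pentagonal_recurrence:
  assumes "0 < n" "n < Suc K * Suc K"
  shows "int (partition_count n) = - fps_nth ((\<Sum>s<K. pentagonal_pair s) * partition_gf) n"
proof -
  have eq: "fps_nth (\<Sum>s<N. pentagonal_pair s) i = fps_nth (\<Sum>s<min N K. pentagonal_pair s) i"
    if "i \<le> n" for i N
  proof -
    have "fps_nth (pentagonal_pair s) i = 0" if "K \<le> s" for s
    proof (rule pentagonal_pair_nth_eq_0)
      have "Suc K * Suc K \<le> Suc s * Suc s" using that by (intro mult_mono) auto
      then show "i < Suc s * Suc s" using assms \<open>i \<le> n\<close> by linarith
    qed
    then show ?thesis
      unfolding fps_sum_nth by (intro sum.mono_neutral_right) auto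
  qed
  have eq': "fps_nth (\<Sum>s<n + K. pentagonal_pair s) i = fps_nth (\<Sum>s<K. pentagonal_pair s) i"
    if "i \<le> n" for i
    using eq[OF that, of "n + K"] by (simp add: min_def)
  \<comment> \<open>Large enough both for the coefficients up to n to be exact and for all K pairs
    to occur in the sum.\<close>
  let ?N = "n + K"
  have "0 = fps_nth ((\<Prod>j=1..?N. 1 - fps_X ^ j) * (partition_fps ?N :: int fps)) n"
    unfolding prod_mult_partition_fps using assms(1) by simp
  also have "\<dots> = fps_nth ((1 + (\<Sum>s<K. pentagonal_pair s)) * partition_gf) n"
    unfolding fps_mult_nth
    by (intro sum.cong refl)
       (simp add: euler_product_nth eq' partition_gf_def partition_fps_nth del: One_nat_def)
  finally show ?thesis
    by (simp add: algebra_simps partition_gf_def)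
qed

section \<open>The pentagonal recurrence as an operation on lists\<close>

primrec sign_of :: "bool option \<Rightarrow> int" where
  "sign_of None = 0"
| "sign_of (Some b) = (if b then 1 else - 1)"

primrec gap :: "nat \<Rightarrow> bool option list \<Rightarrow> bool option list" where
  "gap 0 e = e"
| "gap (Suc n) e = None # gap n e"

text \<open>The generalized pentagonal numbers 1, 2, 5, 7, 12, 15, ... grow alternately by k + 1 and
  by an odd number 2 k + 1, with k counted from 0. Each entry fills one place itself, which leaves
  gaps of k and 2 k empty places.\<close>

primrec pentagonal_signs :: "nat \<Rightarrow> nat \<Rightarrow> bool \<Rightarrow> bool option list" where
  "pentagonal_signs 0 k b = []"
| "pentagonal_signs (Suc n) k b =
     gap (k + k) (Some b # gap k (Some b # pentagonal_signs n (Suc k) (\<not> b)))"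

text \<open>Signs instead of numerical coefficients spare all multiplications in the evaluation, and
  the two accumulators postpone the only subtraction to the end. If \<open>xs\<close> runs out
  first, the remaining pentagonal numbers exceed the argument and contribute nothing.\<close>

fun signed_sum :: "bool option list \<Rightarrow> int list \<Rightarrow> int \<Rightarrow> int \<Rightarrow> int" where
  "signed_sum (None # e) (x # xs) a b = signed_sum e xs a b"
| "signed_sum (Some True # e) (x # xs) a b = signed_sum e xs (a + x) b"
| "signed_sum (Some False # e) (x # xs) a b = signed_sum e xs a (b + x)"
| "signed_sum [] xs a b = a - b"
| "signed_sum (z # e) [] a b = a - b"

primrec sign_fps :: "bool option list \<Rightarrow> int fps" where
  "sign_fps [] = 0"
| "sign_fps (x # e) = fps_const (sign_of x) + fps_X * sign_fps e"

lemma sign_fps_gap: "sign_fps (gap n e) = fps_X ^ n * sign_fps e"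
  by (induction n) (simp_all add: mult.assoc)

text \<open>The power of X moves the list to the place just after k (3 k + 1) / 2, the last exponent
  of the preceding pair; for k = 0 list position i thus stands for exponent i + 1. The minus sign
  comes from solving the recurrence for its leading term.\<close>

lemma sign_fps_pentagonal_signs:
  "fps_X ^ Suc (k * k + triangle k) * sign_fps (pentagonal_signs n k (even k))
     = - (\<Sum>s\<in>{k..<k+n}. pentagonal_pair s)"
proof (induction n arbitrary: k)
  case 0
  then show ?case by simp
next
  case (Suc n)
  have c: "fps_const (sign_of (Some (even k))) = (- ((-1) ^ Suc k) :: int fps)"
  proof -
    have "sign_of (Some (even k)) = (-1) ^ k" by (simp add: minus_one_power_iff)
    then have "fps_const (sign_of (Some (even k))) = (-1) ^ k"
      by (simp only: fps_const_power[symmetric] fps_const_neg[symmetric] fps_const_1_eq_1)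
    then show ?thesis by (simp only: power_Suc mult_minus1 minus_minus)
  qed
  have "fps_X ^ Suc (k * k + triangle k) * sign_fps (pentagonal_signs (Suc n) k (even k))
      = - pentagonal_pair k
        + fps_X ^ Suc (Suc k * Suc k + triangle (Suc k)) * sign_fps (pentagonal_signs n (Suc k) (even (Suc k)))"
    unfolding pentagonal_signs.simps sign_fps_gap sign_fps.simps c pentagonal_pair_def
    by (simp add: algebra_simps power_add)
  also have "\<dots> = - (\<Sum>s\<in>{k..<k + Suc n}. pentagonal_pair s)"
  proof -
    have "{k..<k + Suc n} = insert k {Suc k..<Suc k + n}" by auto
    then show ?thesis unfolding Suc.IH by simp
  qed
  finally show ?case .
qed

text \<open>In descending order entry i is p(n - 1 - i), which is what position i of the sign list
  refers to, and extending the table is a single cons.\<close>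

primrec partition_list :: "nat \<Rightarrow> int list" where
  "partition_list 0 = []"
| "partition_list (Suc n) = int (partition_count n) # partition_list n"

lemma signed_sum_partition_list:
  "signed_sum e (partition_list n) a b
     = a - b + fps_nth (fps_X * (sign_fps e * partition_gf)) n"
proof (induction e arbitrary: n a b)
  case Nil
  then show ?case by simp
next
  case (Cons x e)
  have step: "sign_fps (x # e) * partition_gf
      = fps_const (sign_of x) * partition_gf + fps_X * (sign_fps e * partition_gf)"
    by (simp add: algebra_simps)
  show ?case
  proof (cases n)
    case 0
    then show ?thesis by simp
  next
    case (Suc m)
    have "fps_nth (fps_X * (sign_fps (x # e) * partition_gf)) n
        = sign_of x * int (partition_count m) + fps_nth (fps_X * (sign_fps e * partition_gf)) m"
      unfolding step Suc by (simp add: partition_gf_def)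
    then show ?thesis
    proof (cases x)
      case (Some c)
      then show ?thesis
        using \<open>fps_nth _ n = _\<close> unfolding Suc by (cases c) (simp_all del: sign_fps.simps add: Cons.IH)
    qed (simp del: sign_fps.simps add: Cons.IH Suc)
  qed
qed

lemma partition_list_Suc:
  assumes "0 < n" "n < Suc K * Suc K"
  shows "signed_sum (pentagonal_signs K 0 True) (partition_list n) 0 0 = int (partition_count n)"
  using pentagonal_recurrence[OF assms] sign_fps_pentagonal_signs[of 0 K]
  by (simp add: signed_sum_partition_list atLeast0LessThan flip: mult.assoc)

section \<open>Verification for small arguments\<close>

text \<open>Since (24 n)^(3/2) = 24 sqrt (24 n^3), any w >= sqrt (24 n^3) gives 10 / w <= 240 / (24
  n)^(3/2); hence the 10. In the shortened comparison the middle number is rounded up and the outer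
  ones down, so it errs on the safe side.\<close>

fun ratio_ok :: "nat \<times> int \<Rightarrow> int list \<Rightarrow> bool" where
  "ratio_ok (0, w) (c # b # a # xs) = (b * b * w < a * c * (w + 10))"
| "ratio_ok (Suc k, w) (c # b # a # xs) =
     ((drop_bit (Suc k) b + 1) * (drop_bit (Suc k) b + 1) * w
        \<le> drop_bit (Suc k) a * drop_bit (Suc k) c * (w + 10))"
| "ratio_ok _ _ = True"

text \<open>The recurrence and the comparison share one pass over one table. Equal parameters for
  consecutive arguments are run-length encoded.\<close>

function verify :: "(nat \<times> nat \<times> int) list \<Rightarrow> bool option list \<Rightarrow> int list \<Rightarrow> bool \<Rightarrow> bool" where
  "verify [] e xs ok = ok"
| "verify ((0, q) # bs) e xs ok = verify bs e xs ok"
| "verify ((Suc l, q) # bs) e xs ok =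
     verify ((l, q) # bs) e (signed_sum e xs 0 0 # xs) (ok \<and> ratio_ok q xs)"
  by pat_completeness auto
termination
  by (relation "Wellfounded.measure (\<lambda>(bs, e, xs, ok). \<Sum>(l, q)\<leftarrow>bs. Suc l)") auto

lemma verify_imp_ok: "verify bs e xs ok \<Longrightarrow> ok"
  by (induction bs e xs ok rule: verify.induct) auto

fun blocks_bound :: "int \<Rightarrow> (nat \<times> nat \<times> int) list \<Rightarrow> bool" where
  "blocks_bound n [] = True"
| "blocks_bound n ((l, k, w) # bs) =
     (0 < w \<and> 24 * (n + int l - 1) ^ 3 \<le> w * w \<and> blocks_bound (n + int l) bs)"

definition expand_blocks :: "(nat \<times> nat \<times> int) list \<Rightarrow> (nat \<times> int) list" where
  "expand_blocks bs = concat (map (\<lambda>(l, q). replicate l q) bs)"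

lemma ratio_okD:
  assumes "ratio_ok (k, w) (c # b # a # xs)" "0 \<le> a" "0 \<le> b" "0 \<le> c" "0 < w"
  shows "b * b * w < a * c * (w + 10)"
proof (cases k)
  case 0
  then show ?thesis using assms by simp
next
  case (Suc k')
  define d where "d = (2::int) ^ k"
  have d: "0 < d" by (simp add: d_def)
  define a' b' c' where "a' = a div d" and "b' = b div d" and "c' = c div d"
  have *: "(b' + 1) * (b' + 1) * w \<le> a' * c' * (w + 10)"
    using assms(1) by (simp add: Suc a'_def b'_def c'_def d_def drop_bit_eq_div)
  have a: "0 \<le> a'" "d * a' \<le> a" and c: "0 \<le> c'" "d * c' \<le> c"
    and b: "0 \<le> b'" "b < d * (b' + 1)"
    using assms d unfolding a'_def b'_def c'_def
    by (auto simp: pos_imp_zdiv_nonneg_iff algebra_simps minus_mod_eq_mult_div[symmetric])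
  have "b * b < (d * (b' + 1)) * (d * (b' + 1))"
    using b assms(3) by (intro mult_strict_mono') auto
  then have "b * b * w < (d * (b' + 1)) * (d * (b' + 1)) * w"
    using assms(5) by simp
  also have "\<dots> = d * d * ((b' + 1) * (b' + 1) * w)"
    by (simp add: ac_simps)
  also have "\<dots> \<le> d * d * (a' * c' * (w + 10))"
    using * d by (intro mult_left_mono) auto
  also have "\<dots> = (d * a') * (d * c') * (w + 10)"
    by (simp add: ac_simps)
  also have "\<dots> \<le> a * c * (w + 10)"
    using a c d assms by (intro mult_right_mono mult_mono) auto
  finally show ?thesis .
qed

lemma expand_blocks_simps:
  "expand_blocks [] = []"
  "expand_blocks ((0, q) # bs) = expand_blocks bs"
  "expand_blocks ((Suc l, q) # bs) = q # expand_blocks ((l, q) # bs)"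
  by (simp_all add: expand_blocks_def)

text \<open>The invariant along the run is that the table is a \<open>partition_list\<close>; each
  step prepends the next value by the pentagonal recurrence, valid below (K + 1)^2.\<close>

lemma verifyD:
  assumes "verify bs (pentagonal_signs K 0 True) (partition_list (Suc m)) ok"
    and "i < length (expand_blocks bs)" "m + length (expand_blocks bs) < Suc K * Suc K"
  shows "ratio_ok (expand_blocks bs ! i) (partition_list (Suc (m + i)))"
  using assms
proof (induction bs "pentagonal_signs K 0 True" "partition_list (Suc m)" ok arbitrary: m i rule: verify.induct)
  case (3 l q bs ok)
  have v: "verify ((l, q) # bs) (pentagonal_signs K 0 True)
      (signed_sum (pentagonal_signs K 0 True) (partition_list (Suc m)) 0 0 # partition_list (Suc m))
      (ok \<and> ratio_ok q (partition_list (Suc m)))"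
    using 3(2) by (simp only: verify.simps)
  then have ok: "ratio_ok q (partition_list (Suc m))"
    using verify_imp_ok by blast
  have s: "signed_sum (pentagonal_signs K 0 True) (partition_list (Suc m)) 0 0 # partition_list (Suc m)
      = partition_list (Suc (Suc m))"
    using 3(4) by (subst partition_list_Suc) (auto simp: expand_blocks_simps)
  show ?case
  proof (cases i)
    case 0
    then show ?thesis using ok by (simp add: expand_blocks_simps del: partition_list.simps)
  next
    case (Suc j)
    then have "ratio_ok (expand_blocks ((l, q) # bs) ! j) (partition_list (Suc (Suc m + j)))"
      using 3(3,4) v s by (intro 3(1)) (simp_all add: expand_blocks_simps del: partition_list.simps)
    then show ?thesis by (simp add: Suc expand_blocks_simps del: partition_list.simps)
  qed
qed (simp_all add: expand_blocks_simps del: partition_list.simps)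

text \<open>As n^3 increases, testing the last argument of a block covers the whole block.\<close>

lemma blocks_boundD:
  assumes "blocks_bound n bs" "i < length (expand_blocks bs)" "0 \<le> n"
  shows "0 < snd (expand_blocks bs ! i)
    \<and> 24 * (n + int i) ^ 3 \<le> snd (expand_blocks bs ! i) * snd (expand_blocks bs ! i)"
  using assms
proof (induction bs arbitrary: n i)
  case Nil
  then show ?case by (simp add: expand_blocks_def)
next
  case (Cons b bs)
  obtain l k w where b: "b = (l, k, w)" by (cases b)
  have e: "expand_blocks (b # bs) = replicate l (k, w) @ expand_blocks bs"
    by (simp add: expand_blocks_def b)
  show ?case
  proof (cases "i < l")
    case True
    have "24 * (n + int i) ^ 3 \<le> 24 * (n + int l - 1) ^ 3"
      using True Cons.prems(3) by (intro mult_left_mono power_mono) auto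
    then show ?thesis
      using Cons.prems(1) True unfolding e by (simp add: b nth_append)
  next
    case False
    have "0 < snd (expand_blocks bs ! (i - l))
      \<and> 24 * (n + int l + int (i - l)) ^ 3
        \<le> snd (expand_blocks bs ! (i - l)) * snd (expand_blocks bs ! (i - l))"
      using Cons.prems(1,3) Cons.prems(2)[unfolded e] False by (intro Cons.IH) (auto simp: b)
    then show ?thesis
      using False unfolding e by (simp add: nth_append of_nat_diff)
  qed
qed

text \<open>Each entry \<open>(l, k, w)\<close> covers \<open>l\<close> consecutive arguments \<open>n\<close>, starting with \<open>n = 7\<close>;
  \<open>w\<close> is an upper bound for \<open>sqrt (24 n\<^sup>3)\<close>, and \<open>k\<close> is the number of low-order bits of
  the partition numbers that the comparison may ignore.\<close>

definition ratio_blocks :: "(nat \<times> nat \<times> int) list" where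
  "ratio_blocks = [(2, 0, 111), (3, 0, 179), (1, 0, 204), (6, 0, 375), (11, 0, 766), (17, 0, 1536), (19, 2,
     4096), (43, 7, 8192), (54, 15, 10240), (64, 23, 20480), (73, 31, 32768), (72, 38, 40960),
     (80, 45, 65536), (87, 52, 65536), (95, 59, 81920), (87, 65, 131072), (79, 71, 131072)]"

text \<open>The leading block only fills the table: its weight 0 turns the test into 0 < 10 a c. The
  choice 29 suffices because 801 < 30^2.\<close>

lemma verify_ratio_blocks:
  "verify ((8, 0, 0) # ratio_blocks) (pentagonal_signs 29 0 True) [1] True"
  by code_simp

lemma blocks_bound_ratio_blocks: "blocks_bound 7 ratio_blocks"
  by code_simp

lemma length_expand_ratio_blocks: "length (expand_blocks ratio_blocks) = 793"
  by (simp add: expand_blocks_def ratio_blocks_def)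

lemma partition_count_0: "partition_count 0 = 1"
proof -
  have "{M :: nat multiset. (\<forall>k\<in>#M. 0 < k) \<and> sum_mset M = 0} = {{#}}"
    by (auto simp: sum_mset_0_iff) (metis multiset_nonemptyE less_irrefl)
  then show ?thesis by (simp add: partition_count_def)
qed

lemma small_ratio_bound:
  assumes "7 \<le> n" "n < 800"
  obtains w :: int where "0 < w" "24 * int n ^ 3 \<le> w * w"
    "int (partition_count n) * int (partition_count n) * w
       < int (partition_count (n - 1)) * int (partition_count (n + 1)) * (w + 10)"
proof -
  let ?qs = "expand_blocks ((8, 0, 0) # ratio_blocks)"
  have qs: "?qs = replicate 8 (0, 0) @ expand_blocks ratio_blocks"
    by (simp add: expand_blocks_def)
  let ?q = "expand_blocks ratio_blocks ! (n - 7)"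
  \<comment> \<open>Step i of the run inspects p(i), p(i - 1) and p(i - 2), so the argument n is
    tested in step n + 1.\<close>
  have *: "ratio_ok (?qs ! (n + 1)) (partition_list (Suc (0 + (n + 1))))"
    using verify_ratio_blocks assms
    by (intro verifyD[where K = 29 and ok = True])
       (simp_all add: qs length_expand_ratio_blocks partition_count_0)
  have "?qs ! (n + 1) = ?q"
    using assms by (simp add: qs nth_append)
  moreover have "partition_list (Suc (0 + (n + 1))) = int (partition_count (n + 1)) #
      int (partition_count n) # int (partition_count (n - 1)) # partition_list (n - 1)"
    using assms by (cases n) simp_all
  ultimately have ok: "ratio_ok (fst ?q, snd ?q) (int (partition_count (n + 1)) #
      int (partition_count n) # int (partition_count (n - 1)) # partition_list (n - 1))"
    using * by (simp only: prod.collapse)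
  have bb: "0 < snd ?q \<and> 24 * (7 + int (n - 7)) ^ 3 \<le> snd ?q * snd ?q"
    using assms by (intro blocks_boundD blocks_bound_ratio_blocks) (auto simp: length_expand_ratio_blocks)
  have "int (partition_count n) * int (partition_count n) * snd ?q
       < int (partition_count (n - 1)) * int (partition_count (n + 1)) * (snd ?q + 10)"
    using bb by (intro ratio_okD[OF ok]) auto
  moreover have "7 + int (n - 7) = int n" using assms by simp
  ultimately show ?thesis
    using that[of "snd ?q"] bb by simp
qed

section \<open>Elementary estimates\<close>

lemma one_minus_cos_le: "1 - cos x \<le> x\<^sup>2 / 2" for x :: real
proof -
  obtain t where "cos x = (\<Sum>m<2. cos_coeff m * x ^ m) + cos (t + 1/2 * real 2 * pi) / fact 2 * x ^ 2"
    using Maclaurin_cos_expansion[of x 2] by blast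
  then have *: "cos x = 1 + cos (t + pi) / 2 * x\<^sup>2"
    by (simp add: lessThan_nat_numeral cos_coeff_def fact_numeral)
  have "- 1 / 2 * x\<^sup>2 \<le> cos (t + pi) / 2 * x\<^sup>2"
    by (intro mult_right_mono) auto
  then show ?thesis unfolding * by simp
qed

lemma one_minus_cos_ge: "x\<^sup>2 / 2 - x ^ 4 / 24 \<le> 1 - cos x" for x :: real
proof -
  obtain t where "cos x = (\<Sum>m<4. cos_coeff m * x ^ m) + cos (t + 1/2 * real 4 * pi) / fact 4 * x ^ 4"
    using Maclaurin_cos_expansion[of x 4] by blast
  then have *: "cos x = 1 - x\<^sup>2 / 2 + cos (t + 2 * pi) / 24 * x ^ 4"
    by (simp add: lessThan_nat_numeral cos_coeff_def fact_numeral)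
  have "cos (t + 2 * pi) / 24 * x ^ 4 \<le> 1 / 24 * x ^ 4"
    by (intro mult_right_mono) auto
  then show ?thesis unfolding * by simp
qed

lemma abs_sin_minus_self_le: "\<bar>sin x - x\<bar> \<le> \<bar>x\<bar> ^ 3 / 6" for x :: real
  using Maclaurin_sin_bound[of x 3] by (simp add: lessThan_nat_numeral sin_coeff_def fact_numeral)

section \<open>Inequalities for hyperbolic functions, damping and phase\<close>

lemma sinh_le_mult_cosh:
  assumes "0 \<le> (y::real)"
  shows "sinh y \<le> y * cosh y"
proof -
  have "0 * cosh 0 - sinh 0 \<le> y * cosh y - sinh y"
    by (rule DERIV_nonneg_imp_nondecreasing[OF assms])
       (auto intro!: exI derivative_eq_intros)
  then show ?thesis by simp
qed

text \<open>With j = 2 k + 3 this is 4 j (j - 1) (j - 2) + 3 <= 3^j, the comparison of Taylor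
  coefficients used next; j = 3 gives equality.\<close>

lemma cubic_le_power3:
  "4 * ((2 * real k + 3) * (2 * real k + 2) * (2 * real k + 1)) + 3 \<le> 3 ^ (2 * k + 3)"
proof (induction k)
  case (Suc k)
  have "4 * ((2 * real (Suc k) + 3) * (2 * real (Suc k) + 2) * (2 * real (Suc k) + 1)) + 3
      \<le> 9 * (4 * ((2 * real k + 3) * (2 * real k + 2) * (2 * real k + 1)) + 3)"
    by (simp add: algebra_simps)
  also have "\<dots> \<le> 9 * 3 ^ (2 * k + 3)"
    using Suc.IH by simp
  finally show ?case by (simp add: power_add)
qed simp

text \<open>Lazarevic's inequality. By sinh (3 y) = 3 sinh y + 4 sinh^3 y it compares 4 y^3 cosh y
  with sinh (3 y) - 3 sinh y, which is possible coefficient by coefficient.\<close>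

lemma cube_mult_cosh_le:
  assumes "0 \<le> (y::real)"
  shows "y ^ 3 * cosh y \<le> sinh y ^ 3"
proof -
  define a where "a n = (if even n then 0 else (3 * y) ^ n /\<^sub>R fact n) - 3 * (if even n then 0 else y ^ n /\<^sub>R fact n)" for n
  define b where "b n = (if n < 3 then 0 else 4 * y ^ 3 * (if even (n - 3) then y ^ (n - 3) /\<^sub>R fact (n - 3) else 0))" for n
  have a: "a sums (sinh (3 * y) - 3 * sinh y)"
    unfolding a_def by (intro sums_diff sums_mult sinh_converges)
  have "(\<lambda>n. 4 * y ^ 3 * (if even n then y ^ n /\<^sub>R fact n else 0)) sums (4 * y ^ 3 * cosh y)"
    by (intro sums_mult cosh_converges)
  then have "(\<lambda>n. b (n + 3)) sums (4 * y ^ 3 * cosh y)"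
    by (simp add: b_def cong: if_cong)
  then have b: "b sums (4 * y ^ 3 * cosh y)"
    by (subst (asm) sums_iff_shift) (simp add: b_def lessThan_nat_numeral)
  have "b n \<le> a n" for n
  proof (cases "odd n \<and> 3 \<le> n")
    case True
    then obtain k where n: "n = 2 * k + 3"
      by (metis add.commute add_diff_inverse_nat even_add evenE less_le_not_le nat_le_linear odd_numeral)
    have f: "(fact n :: real) = real n * (real n - 1) * (real n - 2) * fact (n - 3)"
      unfolding n by (simp add: numeral_3_eq_3 algebra_simps)
    have "4 * (real n * (real n - 1) * (real n - 2)) + 3 \<le> 3 ^ n"
      using cubic_le_power3[of k] unfolding n by (simp add: algebra_simps)
    then have "y ^ n * (4 * (real n * (real n - 1) * (real n - 2))) / fact n \<le> y ^ n * (3 ^ n - 3) / fact n"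
      using assms by (intro divide_right_mono mult_left_mono) auto
    also have "y ^ n * (3 ^ n - 3) / fact n = a n"
      using True by (simp add: a_def power_mult_distrib field_simps)
    also have "y ^ n * (4 * (real n * (real n - 1) * (real n - 2))) / fact n = b n"
    proof -
      have "y ^ n = y ^ 3 * y ^ (n - 3)" unfolding n by (simp add: add.commute flip: power_add)
      moreover define c where "c = real n * (real n - 1) * (real n - 2)"
      moreover have "c \<noteq> 0" unfolding c_def n by simp
      ultimately show ?thesis
        using True unfolding f b_def c_def[symmetric] by (simp add: field_simps)
    qed
    finally show ?thesis .
  next
    case False
    show ?thesis
    proof (cases "n < 3")
      case True
      then have "n = 0 \<or> n = 1 \<or> n = 2" by linarith
      then show ?thesis by (auto simp: a_def b_def)
    next
      case False
      then show ?thesis using \<open>\<not> (odd n \<and> 3 \<le> n)\<close> by (auto simp: a_def b_def)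
    qed
  qed
  then have "4 * y ^ 3 * cosh y \<le> sinh (3 * y) - 3 * sinh y"
    by (rule sums_le[OF _ b a])
  moreover have "sinh (3 * y) = 3 * sinh y + 4 * sinh y ^ 3"
  proof -
    have "sinh (3 * y) = sinh (2 * y + y)" by simp
    also have "\<dots> = 2 * sinh y * (cosh y)\<^sup>2 + ((cosh y)\<^sup>2 + (sinh y)\<^sup>2) * sinh y"
      unfolding sinh_add sinh_double cosh_double by (simp add: power2_eq_square)
    also have "\<dots> = 3 * sinh y + 4 * sinh y ^ 3"
      unfolding cosh_square_eq by (simp add: algebra_simps power2_eq_square power3_eq_cube)
    finally show ?thesis .
  qed
  ultimately show ?thesis by simp
qed

lemma cosh_minus_one_eq: "cosh s - 1 = 2 * sinh (s / 2) ^ 2" for s :: real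
  using cosh_double[of "s / 2"] cosh_square_eq[of "s / 2"] by simp

lemma sinh_eq_half: "sinh s = 2 * sinh (s / 2) * cosh (s / 2)" for s :: real
  using sinh_double[of "s / 2"] by simp

text \<open>Lazarevic's inequality at s / 2. It bounds sinh s / (4 (cosh s - 1)^2), the coefficient
  of \<psi>^2 in the damping at \<psi> = 0, by its small-s form 1 / s^3.\<close>

lemma cube_mult_sinh_le:
  assumes "0 \<le> (s::real)"
  shows "s ^ 3 * sinh s \<le> 4 * (cosh s - 1)\<^sup>2"
proof -
  have "s ^ 3 * sinh s = 16 * sinh (s/2) * ((s/2) ^ 3 * cosh (s/2))"
    unfolding sinh_eq_half[of s] by (simp add: power_divide)
  also have "\<dots> \<le> 16 * sinh (s/2) * sinh (s/2) ^ 3"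
    using assms by (intro mult_left_mono cube_mult_cosh_le) auto
  also have "\<dots> = 4 * (cosh s - 1)\<^sup>2"
    unfolding cosh_minus_one_eq by (simp add: power2_eq_square power3_eq_cube)
  finally show ?thesis .
qed

text \<open>Equivalent for s > 0 to tanh (s / 2) <= s / 2; it supplies the factor 1 / s in the lower
  bound for the damping.\<close>

lemma two_cosh_minus_one_le:
  assumes "0 \<le> (s::real)"
  shows "2 * (cosh s - 1) \<le> s * sinh s"
proof -
  have "2 * (cosh s - 1) = 4 * sinh (s/2) * sinh (s/2)"
    unfolding cosh_minus_one_eq by (simp add: power2_eq_square)
  also have "\<dots> \<le> 4 * sinh (s/2) * (s/2 * cosh (s/2))"
    using assms by (intro mult_left_mono sinh_le_mult_cosh) auto
  also have "\<dots> = s * sinh s" unfolding sinh_eq_half[of s] by simp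
  finally show ?thesis .
qed

lemma cosh_minus_one_ge: "s\<^sup>2 / 2 + s ^ 4 / 24 + s ^ 6 / 720 \<le> cosh s - 1" for s :: real
proof -
  let ?f = "\<lambda>n. if even n then s ^ n /\<^sub>R fact n else 0"
  have "sum ?f {..<7} \<le> suminf ?f"
    using cosh_converges[of s] by (intro sum_le_suminf) (auto simp: sums_iff)
  also have "suminf ?f = cosh s" using cosh_converges[of s] by (simp add: sums_iff)
  finally show ?thesis
    by (simp add: lessThan_nat_numeral fact_numeral field_simps)
qed

lemma cosh_minus_one_ge_square: "s\<^sup>2 / 2 \<le> cosh s - 1" for s :: real
proof -
  have "0 \<le> s ^ 4 / 24 + s ^ 6 / 720" by (simp add: zero_le_even_power)
  then show ?thesis using cosh_minus_one_ge[of s] by linarith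
qed

text \<open>In place of a Taylor remainder: sinh (s / 2) <= (s / 2) cosh (s / 2) bounds cosh s - 1
  in terms of itself, and the result is solved for it.\<close>

lemma cosh_minus_one_le:
  assumes "0 \<le> (s::real)"
  shows "(cosh s - 1) * (1 - s\<^sup>2 / 4) \<le> s\<^sup>2 / 2"
proof -
  have "cosh s - 1 = 2 * sinh (s/2) ^ 2" by (rule cosh_minus_one_eq)
  also have "\<dots> \<le> 2 * (s/2 * cosh (s/2)) ^ 2"
    using assms by (intro mult_left_mono power_mono sinh_le_mult_cosh) auto
  also have "\<dots> = s\<^sup>2 / 2 * (1 + sinh (s/2) ^ 2)"
    by (simp add: power_mult_distrib cosh_square_eq power_divide)
  also have "\<dots> = s\<^sup>2 / 2 * (1 + (cosh s - 1) / 2)"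
    unfolding cosh_minus_one_eq by simp
  finally show ?thesis by (simp add: field_simps)
qed

text \<open>With \<open>w = e\<^bsup>-s+i\<psi>\<^esup>\<close>, \<open>damping\<close> is the loss in the real part of \<open>w / (1 - w)\<close> against
  \<open>\<psi> = 0\<close>, and \<open>phase\<close> is its imaginary part minus the term linear in \<open>\<psi>\<close>.\<close>

definition damping :: "real \<Rightarrow> real \<Rightarrow> real" where
  "damping s \<psi> = sinh s * (1 - cos \<psi>) / (2 * (cosh s - 1) * (cosh s - cos \<psi>))"

definition phase :: "real \<Rightarrow> real \<Rightarrow> real" where
  "phase s \<psi> = sin \<psi> / (2 * (cosh s - cos \<psi>)) - \<psi> / (2 * (cosh s - 1))"

lemma cosh_minus_one_pos: "0 < s \<Longrightarrow> 0 < cosh s - 1" for s :: real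
  using cosh_minus_one_ge_square[of s] by (smt (verit) zero_less_power half_gt_zero)

lemma damping_le:
  assumes "0 < s"
  shows "damping s \<psi> \<le> \<psi>\<^sup>2 / s ^ 3"
proof -
  define K v where "K = cosh s - 1" and "v = 1 - cos \<psi>"
  have K: "0 < K" using cosh_minus_one_pos assms by (simp add: K_def)
  have v: "0 \<le> v" "v \<le> \<psi>\<^sup>2 / 2" using one_minus_cos_le by (simp_all add: v_def)
  have "damping s \<psi> = sinh s * v / (2 * K * (K + v))"
    by (simp add: damping_def K_def v_def)
  also have "\<dots> \<le> sinh s * v / (2 * K * K)"
    using K v assms by (intro divide_left_mono mult_left_mono) auto
  also have "\<dots> \<le> (4 * K\<^sup>2 / s ^ 3) * v / (2 * K * K)"
  proof -
    have "sinh s \<le> 4 * K\<^sup>2 / s ^ 3"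
      using cube_mult_sinh_le[of s] assms by (simp add: K_def field_simps)
    then show ?thesis using K v by (intro divide_right_mono mult_right_mono) auto
  qed
  also have "\<dots> = 2 * v / s ^ 3"
    using K by (simp add: power2_eq_square)
  also have "\<dots> \<le> \<psi>\<^sup>2 / s ^ 3"
    using v assms by (intro divide_right_mono) auto
  finally show ?thesis .
qed

lemma damping_nonneg: "0 \<le> s \<Longrightarrow> 0 \<le> damping s \<psi>"
  using cosh_real_ge_1[of s] order_trans[OF cos_le_one[of \<psi>] cosh_real_ge_1[of s]]
  unfolding damping_def
  by (intro divide_nonneg_nonneg mult_nonneg_nonneg) auto

text \<open>On \<open>[0, \<pi>]\<close> the damping is increasing in the angle, so it suffices to bound it at the
  left end of an interval.\<close>

lemma damping_ge:
  assumes s: "0 < s" and \<psi>: "0 \<le> \<psi>\<^sub>0" "\<psi>\<^sub>0 \<le> \<psi>" "\<psi> \<le> pi"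
    and q: "(cosh s - 1) * q \<le> \<psi>\<^sub>0\<^sup>2 / 2 - \<psi>\<^sub>0 ^ 4 / 24" "0 \<le> q"
  shows "1 / s * (q / (1 + q)) \<le> damping s \<psi>"
proof -
  define K v where "K = cosh s - 1" and "v = 1 - cos \<psi>"
  have K: "0 < K" using cosh_minus_one_pos assms by (simp add: K_def)
  have "cos \<psi> \<le> cos \<psi>\<^sub>0" using \<psi> by (intro cos_monotone_0_pi_le) auto
  then have v: "K * q \<le> v"
    using one_minus_cos_ge[of \<psi>\<^sub>0] q by (simp add: K_def v_def)
  have v0: "0 \<le> v" by (simp add: v_def)
  have "q / (1 + q) \<le> v / (K + v)"
    using K v v0 q(2) by (simp add: field_simps)
  moreover have "1 / s \<le> sinh s / (2 * K)"
    using two_cosh_minus_one_le[of s] s K by (simp add: K_def field_simps)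
  ultimately have "1 / s * (q / (1 + q)) \<le> sinh s / (2 * K) * (v / (K + v))"
    using s K q(2) by (intro mult_mono) auto
  also have "\<dots> = damping s \<psi>" by (simp add: damping_def K_def v_def)
  finally show ?thesis .
qed

text \<open>The estimate passes through |\<psi>|^3 (K + 3) / (12 K^2) with K = cosh s - 1, which
  behaves like |\<psi>|^3 / s^4 for small s; the factor 11 / 10 makes this uniform in s.\<close>

lemma abs_phase_le:
  assumes "0 < s"
  shows "\<bar>phase s \<psi>\<bar> \<le> 11 / 10 * \<bar>\<psi>\<bar> ^ 3 / s ^ 4"
proof -
  define K v where "K = cosh s - 1" and "v = 1 - cos \<psi>"
  have K: "0 < K" using cosh_minus_one_pos assms by (simp add: K_def)
  have v: "0 \<le> v" "v \<le> \<psi>\<^sup>2 / 2" using one_minus_cos_le by (simp_all add: v_def)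
  have "phase s \<psi> = sin \<psi> / (2 * (K + v)) - \<psi> / (2 * K)"
    by (simp add: phase_def K_def v_def)
  also have "\<dots> = (K * (sin \<psi> - \<psi>) - \<psi> * v) / (2 * K * (K + v))"
    using K v(1) by (simp add: divide_simps) (simp add: algebra_simps)
  finally have "\<bar>phase s \<psi>\<bar> = \<bar>K * (sin \<psi> - \<psi>) - \<psi> * v\<bar> / (2 * K * (K + v))"
    using K v(1) by (simp add: abs_mult)
  also have "\<dots> \<le> \<bar>K * (sin \<psi> - \<psi>) - \<psi> * v\<bar> / (2 * K * K)"
    using K v by (intro divide_left_mono mult_left_mono) auto
  also have "\<bar>K * (sin \<psi> - \<psi>) - \<psi> * v\<bar> \<le> K * \<bar>sin \<psi> - \<psi>\<bar> + \<bar>\<psi>\<bar> * v"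
    using K v(1) abs_triangle_ineq4[of "K * (sin \<psi> - \<psi>)" "\<psi> * v"] by (simp add: abs_mult)
  also have "\<dots> \<le> K * (\<bar>\<psi>\<bar> ^ 3 / 6) + \<bar>\<psi>\<bar> * (\<psi>\<^sup>2 / 2)"
    using K v by (intro add_mono mult_left_mono abs_sin_minus_self_le) auto
  also have "\<dots> = \<bar>\<psi>\<bar> ^ 3 * (K + 3) / 6"
    by (simp add: field_simps power3_eq_cube power2_eq_square flip: abs_mult)
  finally have 1: "\<bar>phase s \<psi>\<bar> \<le> \<bar>\<psi>\<bar> ^ 3 * (K + 3) / 6 / (2 * K * K)"
    using K by (simp add: divide_right_mono)
  \<comment> \<open>In the variable w the Taylor bound for \<open>K\<close> is 6 w r, and at K = 6 w
    r the required \<open>s ^ 4 * (K + 3) \<le> 66 / 5 * K\<^sup>2\<close> reduces to 2 w r + 1 <=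
    11/10 r^2.\<close>
  define w where "w = s\<^sup>2 / 12"
  define r where "r = 1 + w + 2/5 * w\<^sup>2"
  have w: "0 < w" using assms by (simp add: w_def)
  have s4: "s ^ 4 = 144 * w\<^sup>2"
    by (simp add: w_def power_divide flip: power_mult)
  have Kr: "6 * w * r \<le> K"
    using cosh_minus_one_ge[of s] by (simp add: K_def r_def w_def field_simps power_divide flip: power_mult power_add)
  have "1 / 10 + 1 / 5 * w - 1 / 50 * w\<^sup>2 + 2 / 25 * w ^ 3 \<ge> 0"
  proof (cases "w \<le> 1")
    case True
    then have "w\<^sup>2 \<le> 1" using w by (simp add: power_le_one)
    moreover have "0 \<le> w ^ 3" using w by simp
    ultimately show ?thesis using w by linarith
  next
    case False
    then have "w ^ 2 \<le> w ^ 3" by (intro power_increasing) auto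
    moreover have "0 \<le> w ^ 2" by simp
    ultimately show ?thesis using w by linarith
  qed
  moreover have "11 / 10 * r\<^sup>2 - 2 * w * r - 1
      = 1 / 10 + 1 / 5 * w - 1 / 50 * w\<^sup>2 + 2 / 25 * w ^ 3 + 22 / 125 * w ^ 4"
    by (simp add: r_def algebra_simps power2_eq_square power3_eq_cube power4_eq_xxxx)
  moreover have "0 \<le> 22 / 125 * w ^ 4" by simp
  ultimately have r: "2 * w * r + 1 \<le> 11 / 10 * r\<^sup>2" by linarith
  \<comment> \<open>This makes 66/5 K - 144 w^2 nonnegative at K = 6 w r, so that its product with K
    can only grow when 6 w r is replaced by the true \<open>K\<close>.\<close>
  have "w * (w - 21 / 20)\<^sup>2 = w ^ 3 - 21 / 10 * w\<^sup>2 + 441 / 400 * w"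
    and "66 / 5 * (6 * w * r) = 396 / 5 * w + 396 / 5 * w\<^sup>2 + 792 / 25 * w ^ 3"
    by (simp_all add: r_def power2_eq_square power3_eq_cube algebra_simps)
  moreover have "0 \<le> w * (w - 21 / 20)\<^sup>2" "0 \<le> w\<^sup>2" using w by simp_all
  ultimately have pos: "144 * w\<^sup>2 \<le> 66 / 5 * (6 * w * r)"
    using w by linarith
  have "6 * w * r * (66 / 5 * (6 * w * r) - 144 * w\<^sup>2) \<le> K * (66 / 5 * K - 144 * w\<^sup>2)"
    using Kr K pos w by (intro mult_mono) linarith+
  moreover have "432 * w\<^sup>2 \<le> 6 * w * r * (66 / 5 * (6 * w * r) - 144 * w\<^sup>2)"
  proof -
    have "432 * w\<^sup>2 * (2 * w * r + 1) \<le> 432 * w\<^sup>2 * (11 / 10 * r\<^sup>2)"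
      using r by (intro mult_left_mono) auto
    then show ?thesis by (simp add: algebra_simps power2_eq_square)
  qed
  ultimately have "s ^ 4 * (K + 3) \<le> 66 / 5 * K\<^sup>2"
    unfolding s4 by (simp add: algebra_simps power2_eq_square)
  then have "(K + 3) / 6 / (2 * K * K) \<le> 11 / 10 / s ^ 4"
    using K assms by (simp add: field_simps power2_eq_square)
  then have "\<bar>\<psi>\<bar> ^ 3 * ((K + 3) / 6 / (2 * K * K)) \<le> \<bar>\<psi>\<bar> ^ 3 * (11 / 10 / s ^ 4)"
    by (intro mult_left_mono) auto
  then show ?thesis using 1 by (simp add: mult.commute)
qed

section \<open>The generating function on a circle\<close>

definition bounded_gf :: "nat \<Rightarrow> complex \<Rightarrow> complex" where
  "bounded_gf k z = inverse (\<Prod>j=1..k. 1 - z ^ j)"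

lemma power_neq_1: "norm z < 1 \<Longrightarrow> 0 < j \<Longrightarrow> z ^ j \<noteq> (1::complex)"
proof
  assume z: "norm z < 1" "0 < j" and "z ^ j = 1"
  moreover have "norm (z ^ j) < 1"
    using z by (simp add: norm_power power_less_one_iff)
  ultimately show False by simp
qed

lemma bounded_gf_sums:
  assumes "norm z < 1"
  shows "(\<lambda>n. of_nat (card (bounded_partitions k n)) * z ^ n) sums bounded_gf k z"
proof -
  let ?P = "\<Prod>j=1..k. 1 - fps_X ^ j :: complex fps"
  have P: "(\<lambda>z. \<Prod>j=1..k. 1 - z ^ j) has_fps_expansion ?P"
    by (intro fps_expansion_intros has_fps_expansion_fps_X_power)
  have inv: "inverse ?P = partition_fps k"
    by (intro fps_inverse_unique prod_mult_partition_fps)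
  have "fps_nth ?P 0 \<noteq> 0"
  proof
    assume "fps_nth ?P 0 = 0"
    then have "fps_nth (?P * partition_fps k) 0 = 0" by (simp only: fps_mult_nth_0 mult_zero_left)
    then show False by (simp only: prod_mult_partition_fps fps_one_nth) simp
  qed
  then have "bounded_gf k has_fps_expansion partition_fps k"
    unfolding bounded_gf_def inv[symmetric] by (intro fps_expansion_intros P)
  moreover have "bounded_gf k holomorphic_on eball 0 1"
    unfolding bounded_gf_def
    by (intro holomorphic_intros) (auto simp: in_eball_iff power_neq_1)
  ultimately have "(\<lambda>n. fps_nth (partition_fps k) n * z ^ n) sums bounded_gf k z"
    using assms by (intro has_fps_expansion_imp_sums_complex[where r = 1]) auto
  then show ?thesis by (simp add: partition_fps_def)
qed

lemma has_integral_cos_multiple: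
  "((\<lambda>\<theta>. cos (real_of_int m * \<theta>)) has_integral (if m = 0 then pi else 0)) {0..pi}"
proof (cases "m = 0")
  case True
  then show ?thesis using has_integral_const_real[of "1::real" 0 pi] by simp
next
  case False
  have "((\<lambda>\<theta>. cos (real_of_int m * \<theta>)) has_integral
      sin (real_of_int m * pi) / real_of_int m - sin (real_of_int m * 0) / real_of_int m) {0..pi}"
    using False
    by (intro fundamental_theorem_of_calculus)
       (auto intro!: derivative_eq_intros simp flip: has_real_derivative_iff_has_vector_derivative)
  moreover have "sin (real_of_int m * pi) = 0" by (simp add: sin_zero_iff_int2) 
  ultimately show ?thesis using False by simp
qed

text \<open>Cauchy's coefficient formula on a half circle: the coefficients are real, so the real
  part is a cosine series in (n - N) \<theta>, and these cosines are orthogonal to constants on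
  [0, \<pi>] unless n = N.\<close>

lemma bounded_gf_has_integral:
  assumes r: "0 \<le> r" "r < 1" and N: "N \<le> k"
  shows "((\<lambda>\<theta>. Re (bounded_gf k (of_real r * cis \<theta>) * cis (- real N * \<theta>)))
           has_integral (pi * real (partition_count N) * r ^ N)) {0..pi}"
proof -
  define c where "c n = real (card (bounded_partitions k n)) * r ^ n" for n
  have cN: "c N = real (partition_count N) * r ^ N"
    using partition_fps_nth[OF N, where 'a = real] by (simp add: c_def partition_fps_def)
  define f where "f n \<theta> = c n * cos (real_of_int (int n - int N) * \<theta>)" for n \<theta>
  have "(\<lambda>n. complex_of_real (c n)) sums bounded_gf k (of_real r)"
    using bounded_gf_sums[of "of_real r" k] r by (simp add: c_def)
  then have "summable (\<lambda>n. complex_of_real (c n))" by (rule sums_summable)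
  then have c: "summable c" by (simp add: summable_complex_of_real)
  have f: "(\<lambda>n. f n \<theta>) sums Re (bounded_gf k (of_real r * cis \<theta>) * cis (- real N * \<theta>))" for \<theta>
  proof -
    have "(\<lambda>n. of_nat (card (bounded_partitions k n)) * (of_real r * cis \<theta>) ^ n * cis (- real N * \<theta>))
        sums (bounded_gf k (of_real r * cis \<theta>) * cis (- real N * \<theta>))"
      using r by (intro sums_mult2 bounded_gf_sums) (simp add: norm_mult)
    then have "(\<lambda>n. Re (of_nat (card (bounded_partitions k n)) * (of_real r * cis \<theta>) ^ n * cis (- real N * \<theta>)))
        sums Re (bounded_gf k (of_real r * cis \<theta>) * cis (- real N * \<theta>))"
      by (rule sums_Re)
    moreover have "Re (of_nat (card (bounded_partitions k n)) * (of_real r * cis \<theta>) ^ n * cis (- real N * \<theta>)) = f n \<theta>" for n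
    proof -
      have "of_nat (card (bounded_partitions k n)) * (of_real r * cis \<theta>) ^ n * cis (- real N * \<theta>)
          = of_real (c n) * (cis (real n * \<theta>) * cis (- real N * \<theta>))"
        by (simp add: c_def power_mult_distrib Complex.DeMoivre)
      also have "cis (real n * \<theta>) * cis (- real N * \<theta>) = cis (real_of_int (int n - int N) * \<theta>)"
        by (simp add: cis_mult algebra_simps)
      finally show ?thesis by (simp add: f_def)
    qed
    ultimately show ?thesis by simp
  qed
  have "uniform_limit {0..pi} (\<lambda>L \<theta>. \<Sum>n<L. f n \<theta>) (\<lambda>\<theta>. suminf (\<lambda>n. f n \<theta>)) sequentially"
  proof (rule Weierstrass_m_test[OF _ c])
    fix n \<theta>
    have "c n * \<bar>cos (real_of_int (int n - int N) * \<theta>)\<bar> \<le> c n * 1"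
      using r by (intro mult_left_mono) (auto simp: c_def)
    then show "norm (f n \<theta>) \<le> c n"
      using r by (simp add: f_def abs_mult c_def)
  qed
  moreover have "suminf (\<lambda>n. f n \<theta>) = Re (bounded_gf k (of_real r * cis \<theta>) * cis (- real N * \<theta>))" for \<theta>
    using f[of \<theta>] by (simp add: sums_iff)
  ultimately have "uniform_limit {0..pi} (\<lambda>L \<theta>. \<Sum>n<L. f n \<theta>)
      (\<lambda>\<theta>. Re (bounded_gf k (of_real r * cis \<theta>) * cis (- real N * \<theta>))) sequentially"
    by simp
  then obtain I J where I: "\<And>L. ((\<lambda>\<theta>. \<Sum>n<L. f n \<theta>) has_integral I L) {0..pi}"
    and J: "((\<lambda>\<theta>. Re (bounded_gf k (of_real r * cis \<theta>) * cis (- real N * \<theta>))) has_integral J) {0..pi}"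
    and IJ: "I \<longlonglongrightarrow> J"
  proof (rule uniform_limit_integral)
    show "continuous_on {0..pi} (\<lambda>\<theta>. \<Sum>n<L. f n \<theta>)" for L
      unfolding f_def by (intro continuous_intros)
  qed auto
  have "I L = pi * c N" if "N < L" for L
  proof (rule has_integral_unique[OF I])
    have "((\<lambda>\<theta>. \<Sum>n<L. f n \<theta>) has_integral (\<Sum>n<L. c n * (if int n - int N = 0 then pi else 0))) {0..pi}"
      unfolding f_def by (intro has_integral_sum has_integral_mult_right has_integral_cos_multiple) auto
    also have "(\<Sum>n<L. c n * (if int n - int N = 0 then pi else 0)) = (\<Sum>n<L. if n = N then pi * c N else 0)"
      by (intro sum.cong) auto
    also have "\<dots> = pi * c N" using that by simp
    finally show "((\<lambda>\<theta>. \<Sum>n<L. f n \<theta>) has_integral pi * c N) {0..pi}" .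
  qed
  then have "I \<longlonglongrightarrow> pi * c N"
    by (intro tendsto_eventually eventually_sequentiallyI[of "Suc N"]) auto
  then have "J = pi * c N" using IJ LIMSEQ_unique by blast
  then show ?thesis using J by (simp add: cN mult.assoc)
qed

section \<open>Passage to the infinite product\<close>

definition log_gf :: "complex \<Rightarrow> complex" where
  "log_gf z = (\<Sum>m. z ^ m / (1 - z ^ m) / of_nat m)"

text \<open>Expanding the logarithms gives a double series over j and m. Tannery's theorem lets the
  sum over j go to infinity inside the sum over m, where it is geometric.\<close>

lemma bounded_gf_tendsto:
  assumes "norm z < 1"
  shows "(\<lambda>k. bounded_gf k z) \<longlonglongrightarrow> exp (log_gf z)"
proof -
  define a where "a m k = (\<Sum>j=1..k. (z ^ j) ^ m) / of_nat m" for m k :: nat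
  have nz: "norm (z ^ j) < 1" if "0 < j" for j
    using assms that by (simp add: norm_power power_less_one_iff)
  have eq: "bounded_gf k z = exp (\<Sum>m. a m k)" for k
  proof -
    have l: "(\<lambda>m. (z ^ j) ^ m / of_nat m) sums - ln (1 - z ^ j)" if "j \<in> {1..k}" for j
      using sums_minus[OF Ln_series'[of "- (z ^ j)"]] nz[of j] that by simp
    have "(\<lambda>m. \<Sum>j=1..k. (z ^ j) ^ m / of_nat m) sums (\<Sum>j=1..k. - ln (1 - z ^ j))"
      by (intro sums_sum l)
    then have "(\<Sum>m. a m k) = (\<Sum>j=1..k. - ln (1 - z ^ j))"
      by (simp add: a_def sums_iff sum_divide_distrib)
    also have "exp \<dots> = (\<Prod>j=1..k. inverse (1 - z ^ j))"
      using power_neq_1[OF assms] by (simp add: exp_sum exp_minus)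
    finally show ?thesis by (simp add: bounded_gf_def prod_inversef[symmetric] o_def)
  qed
  have "(\<lambda>k. suminf (\<lambda>m. a m k)) \<longlonglongrightarrow> suminf (\<lambda>m. z ^ m / (1 - z ^ m) / of_nat m)"
  proof (rule tannerys_theorem[THEN conjunct2, THEN conjunct2])
    fix m
    show "(\<lambda>k. a m k) \<longlonglongrightarrow> z ^ m / (1 - z ^ m) / of_nat m"
    proof (cases "m = 0")
      case False
      have "(\<lambda>k. \<Sum>j<k. (z ^ m) ^ Suc j) \<longlonglongrightarrow> z ^ m * (1 / (1 - z ^ m))"
        using sums_mult[OF geometric_sums[OF nz[of m]], of "z ^ m"] False by (simp add: sums_def)
      moreover have "(\<Sum>j=1..k. (z ^ j) ^ m) = (\<Sum>j<k. (z ^ m) ^ Suc j)" for k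
        by (intro sum.reindex_bij_witness[where i = Suc and j = "\<lambda>j. j - 1"])
           (auto simp: power_mult[symmetric] mult.commute simp del: power_Suc)
      ultimately show ?thesis
        unfolding a_def by (intro tendsto_divide) (use False in auto)
    qed (simp add: a_def)
  next
    have "norm (a m k) \<le> norm z ^ m * (1 / (1 - norm z))" for m k
    proof (cases "m = 0")
      case False
      have "norm (a m k) \<le> (\<Sum>j=1..k. norm ((z ^ j) ^ m)) / real m"
        unfolding a_def by (simp add: norm_divide divide_right_mono sum_norm_le)
      also have "\<dots> \<le> (\<Sum>j=1..k. norm ((z ^ j) ^ m)) / 1"
        using False by (intro divide_left_mono sum_nonneg) auto
      also have "\<dots> \<le> (\<Sum>j=1..k. norm z ^ m * norm z ^ (j - 1))"
      proof -
        have "norm ((z ^ j) ^ m) \<le> norm z ^ m * norm z ^ (j - 1)" if "j \<in> {1..k}" for j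
        proof -
          \<comment> \<open>This is (j - 1) (m - 1) >= 0; it splits the double series into a product
            of two geometric ones.\<close>
          have "m + (j - 1) \<le> j * m"
            using that False by (cases j; cases m) (auto simp: algebra_simps)
          then have "norm z ^ (j * m) \<le> norm z ^ (m + (j - 1))"
            using assms by (intro power_decreasing) auto
          then show ?thesis by (simp add: norm_power power_mult power_add)
        qed
        then show ?thesis unfolding div_by_1 by (intro sum_mono)
      qed
      also have "\<dots> = norm z ^ m * (\<Sum>j<k. norm z ^ j)"
        unfolding sum_distrib_left
        by (intro sum.reindex_bij_witness[where i = Suc and j = "\<lambda>j. j - 1"]) auto
      also have "\<dots> \<le> norm z ^ m * (1 / (1 - norm z))"
        using sum_le_suminf[of "\<lambda>j. norm z ^ j" "{..<k}"] assms
        by (intro mult_left_mono) (simp_all add: suminf_geometric summable_geometric)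
      finally show ?thesis .
    qed (use assms in \<open>simp add: a_def\<close>)
    then show "\<forall>\<^sub>F (m, k) in at_top \<times>\<^sub>F sequentially. norm (a m k) \<le> norm z ^ m * (1 / (1 - norm z))"
      by (simp add: case_prod_unfold)
    show "summable (\<lambda>m. norm z ^ m * (1 / (1 - norm z)))"
      using assms by (intro summable_mult2 summable_geometric) auto
  qed auto
  then show ?thesis
    unfolding eq log_gf_def by (intro tendsto_exp)
qed

text \<open>Factor by factor |1 - z^j| >= 1 - |z|^j. As the values at r converge in k, they yield
  one dominating constant for all angles and all k.\<close>

lemma norm_bounded_gf_le:
  assumes "0 \<le> r" "r < 1"
  shows "norm (bounded_gf k (of_real r * cis \<theta>)) \<le> norm (bounded_gf k (of_real r))"
proof -
  have "norm (1 - complex_of_real r ^ j) \<le> norm (1 - (of_real r * cis \<theta>) ^ j)" if "j \<in> {1..k}" for j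
  proof -
    have "r ^ j \<le> 1" using assms by (simp add: power_le_one)
    then have "norm (1 - complex_of_real r ^ j) = 1 - r ^ j"
      using norm_of_real[of "1 - r ^ j", where 'a = complex] by simp
    also have "\<dots> = 1 - norm ((of_real r * cis \<theta>) ^ j)"
      using assms by (simp add: norm_power norm_mult)
    also have "\<dots> \<le> norm (1 - (of_real r * cis \<theta>) ^ j)"
      using norm_triangle_ineq2[of 1 "(of_real r * cis \<theta>) ^ j"] by simp
    finally show ?thesis .
  qed
  then have "norm (\<Prod>j=1..k. 1 - complex_of_real r ^ j) \<le> norm (\<Prod>j=1..k. 1 - (of_real r * cis \<theta>) ^ j)"
    unfolding prod_norm[symmetric] by (intro prod_mono) auto
  moreover have "(\<Prod>j=1..k. 1 - complex_of_real r ^ j) \<noteq> 0"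
    using assms power_neq_1[of "of_real r"] by auto
  ultimately show ?thesis
    unfolding bounded_gf_def norm_inverse by (intro le_imp_inverse_le) auto
qed

lemma partition_count_has_integral:
  assumes r: "0 \<le> r" "r < 1"
  shows "((\<lambda>\<theta>. Re (exp (log_gf (of_real r * cis \<theta>)) * cis (- real N * \<theta>)))
           has_integral (pi * real (partition_count N) * r ^ N)) {0..pi}"
proof -
  \<comment> \<open>The index \<open>k + N\<close> makes coefficient N exact for every k, so the
    integrals form a constant sequence.\<close>
  let ?f = "\<lambda>k \<theta>. Re (bounded_gf (k + N) (of_real r * cis \<theta>) * cis (- real N * \<theta>))"
  let ?g = "\<lambda>\<theta>. Re (exp (log_gf (of_real r * cis \<theta>)) * cis (- real N * \<theta>))"
  have f: "(?f k has_integral (pi * real (partition_count N) * r ^ N)) {0..pi}" for k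
    by (intro bounded_gf_has_integral assms) auto
  have "Bseq (\<lambda>k. bounded_gf k (of_real r))"
    using bounded_gf_tendsto[of "of_real r"] r
    by (intro convergent_imp_Bseq) (auto simp: convergent_def)
  then obtain B where B: "\<And>k. norm (bounded_gf k (of_real r)) \<le> B"
    by (auto simp: Bseq_def)
  have bound: "norm (?f k \<theta>) \<le> B" for k \<theta>
  proof -
    have "norm (?f k \<theta>) \<le> norm (bounded_gf (k + N) (of_real r * cis \<theta>) * cis (- real N * \<theta>))"
      unfolding real_norm_def by (rule abs_Re_le_cmod)
    also have "\<dots> = norm (bounded_gf (k + N) (of_real r * cis \<theta>))" by (simp add: norm_mult)
    also have "\<dots> \<le> B" using norm_bounded_gf_le[OF r] B order_trans by blast
    finally show ?thesis .
  qed
  have conv: "(\<lambda>k. ?f k \<theta>) \<longlonglongrightarrow> ?g \<theta>" for \<theta>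
    using r by (intro tendsto_intros LIMSEQ_ignore_initial_segment bounded_gf_tendsto)
               (simp add: norm_mult)
  have "?g integrable_on {0..pi}" "(\<lambda>k. integral {0..pi} (?f k)) \<longlonglongrightarrow> integral {0..pi} ?g"
    using dominated_convergence[of ?f "{0..pi}" "\<lambda>_. B" ?g] f bound conv
    by (auto simp: integrable_on_def)
  moreover have "integral {0..pi} (?f k) = pi * real (partition_count N) * r ^ N" for k
    using f by (rule integral_unique)
  ultimately show ?thesis
    by (simp add: LIMSEQ_const_iff has_integral_integrable_integral)
qed

section \<open>Total damping, total phase and mean size\<close>

lemma inverse_square_sums: "(\<lambda>m. 1 / real m ^ 2) sums (pi\<^sup>2 / 6)"
  using inverse_squares_sums sums_Suc_iff[of "\<lambda>m. 1 / real m ^ 2"] by (simp add: add.commute)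

lemma pi_square_sixth_le: "pi\<^sup>2 / 6 \<le> 329 / 200"
proof -
  have "pi\<^sup>2 \<le> 3.1415926535899\<^sup>2"
    using pi_approx(2) by (intro power_mono) auto
  then show ?thesis by (simp add: power2_eq_square)
qed

text \<open>The summation starts at m = 0, where the term is 0 because division by 0 yields 0; the
  same convention is at work in \<open>log_gf\<close>, \<open>total_phase\<close> and
  \<open>mean_size\<close>.\<close>

definition total_damping :: "real \<Rightarrow> real \<Rightarrow> real" where
  "total_damping t \<theta> = (\<Sum>m. damping (real m * t) (real m * \<theta>) / real m)"

definition total_phase :: "real \<Rightarrow> real \<Rightarrow> real" where
  "total_phase t \<theta> = (\<Sum>m. phase (real m * t) (real m * \<theta>) / real m)"

text \<open>The terms equal e^(-mt) / (1 - e^(-mt))^2, so this is the negative t-derivative of log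
  P(e^(-t)): the expected size of a random partition weighted by e^(-t) to the power of its
  size.\<close>

definition mean_size :: "real \<Rightarrow> real" where
  "mean_size t = (\<Sum>m. 1 / (2 * (cosh (real m * t) - 1)))"

text \<open>The bound \<psi>^2 / s^3 is homogeneous: scaling both arguments by m and dividing by m
  leaves 1 / m^2, which sums to \<pi>^2 / 6. The phase bound scales in the same way.\<close>

lemma damping_term_bounds:
  assumes "0 < t"
  shows "0 \<le> damping (real m * t) (real m * \<theta>) / real m"
    and "damping (real m * t) (real m * \<theta>) / real m \<le> \<theta>\<^sup>2 / t ^ 3 * (1 / real m ^ 2)"
proof -
  show "0 \<le> damping (real m * t) (real m * \<theta>) / real m"
    using assms by (intro divide_nonneg_nonneg damping_nonneg) auto
  show "damping (real m * t) (real m * \<theta>) / real m \<le> \<theta>\<^sup>2 / t ^ 3 * (1 / real m ^ 2)"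
  proof (cases "m = 0")
    case False
    then have "damping (real m * t) (real m * \<theta>) / real m \<le> (real m * \<theta>)\<^sup>2 / (real m * t) ^ 3 / real m"
      using assms by (intro divide_right_mono damping_le) auto
    also have "\<dots> = \<theta>\<^sup>2 / t ^ 3 * (1 / real m ^ 2)"
      using False assms by (simp add: field_simps power2_eq_square power3_eq_cube)
    finally show ?thesis .
  qed simp
qed

lemma summable_damping:
  assumes "0 < t"
  shows "summable (\<lambda>m. damping (real m * t) (real m * \<theta>) / real m)"
proof (rule summable_comparison_test')
  show "summable (\<lambda>m. \<theta>\<^sup>2 / t ^ 3 * (1 / real m ^ 2))"
    using inverse_square_sums by (intro summable_mult) (rule sums_summable)
  show "norm (damping (real m * t) (real m * \<theta>) / real m) \<le> \<theta>\<^sup>2 / t ^ 3 * (1 / real m ^ 2)" for m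
    using damping_term_bounds[OF assms, of m \<theta>] by (simp only: real_norm_def abs_of_nonneg)
qed

lemma total_damping_le:
  assumes "0 < t"
  shows "total_damping t \<theta> \<le> 329 / 200 * \<theta>\<^sup>2 / t ^ 3"
proof -
  have "total_damping t \<theta> \<le> \<theta>\<^sup>2 / t ^ 3 * (pi\<^sup>2 / 6)"
    unfolding total_damping_def
    by (rule sums_le[OF _ summable_sums[OF summable_damping] sums_mult[OF inverse_square_sums]])
       (use assms damping_term_bounds in auto)
  also have "\<dots> \<le> \<theta>\<^sup>2 / t ^ 3 * (329 / 200)"
    using assms pi_square_sixth_le by (intro mult_left_mono) auto
  finally show ?thesis by simp
qed

lemma sum_damping_le_total:
  assumes "0 < t" "finite A"
  shows "(\<Sum>m\<in>A. damping (real m * t) (real m * \<theta>) / real m) \<le> total_damping t \<theta>"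
  unfolding total_damping_def
  by (intro sum_le_suminf summable_damping damping_term_bounds assms)

lemma phase_term_bound:
  assumes "0 < t"
  shows "\<bar>phase (real m * t) (real m * \<theta>) / real m\<bar> \<le> 11 / 10 * \<bar>\<theta>\<bar> ^ 3 / t ^ 4 * (1 / real m ^ 2)"
proof (cases "m = 0")
  case False
  have "\<bar>phase (real m * t) (real m * \<theta>) / real m\<bar> = \<bar>phase (real m * t) (real m * \<theta>)\<bar> / real m"
    by simp
  also have "\<dots> \<le> (11 / 10 * \<bar>real m * \<theta>\<bar> ^ 3 / (real m * t) ^ 4) / real m"
    using False assms by (intro divide_right_mono abs_phase_le) auto
  also have "\<dots> = 11 / 10 * \<bar>\<theta>\<bar> ^ 3 / t ^ 4 * (1 / real m ^ 2)"
    using False assms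
    by (simp add: field_simps abs_mult power2_eq_square power3_eq_cube power4_eq_xxxx)
  finally show ?thesis .
qed simp

lemma summable_phase:
  assumes "0 < t"
  shows "summable (\<lambda>m. \<bar>phase (real m * t) (real m * \<theta>) / real m\<bar>)"
proof (rule summable_comparison_test')
  show "summable (\<lambda>m. 11 / 10 * \<bar>\<theta>\<bar> ^ 3 / t ^ 4 * (1 / real m ^ 2))"
    using inverse_square_sums by (intro summable_mult) (rule sums_summable)
  show "norm \<bar>phase (real m * t) (real m * \<theta>) / real m\<bar> \<le> 11 / 10 * \<bar>\<theta>\<bar> ^ 3 / t ^ 4 * (1 / real m ^ 2)" for m
    using phase_term_bound[OF assms, of m \<theta>] by simp
qed

lemma abs_total_phase_le:
  assumes "0 < t"
  shows "\<bar>total_phase t \<theta>\<bar> \<le> 181 / 100 * \<bar>\<theta>\<bar> ^ 3 / t ^ 4"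
proof -
  have "\<bar>total_phase t \<theta>\<bar> \<le> (\<Sum>m. \<bar>phase (real m * t) (real m * \<theta>) / real m\<bar>)"
    unfolding total_phase_def by (rule summable_rabs[OF summable_phase[OF assms]])
  also have "\<dots> \<le> 11 / 10 * \<bar>\<theta>\<bar> ^ 3 / t ^ 4 * (pi\<^sup>2 / 6)"
    by (rule sums_le[OF _ summable_sums[OF summable_phase[OF assms]] sums_mult[OF inverse_square_sums]])
       (rule phase_term_bound[OF assms])
  also have "\<dots> \<le> 11 / 10 * \<bar>\<theta>\<bar> ^ 3 / t ^ 4 * (329 / 200)"
    using assms pi_square_sixth_le by (intro mult_left_mono) auto
  also have "\<dots> \<le> 181 / 100 * \<bar>\<theta>\<bar> ^ 3 / t ^ 4"
  proof -
    have "0 \<le> \<bar>\<theta>\<bar> ^ 3 / t ^ 4" using assms by simp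
    then show ?thesis
      \<comment> \<open>3619/2000 is 11/10 times 329/200.\<close>
      using mult_right_mono[of "3619 / 2000" "181 / 100" "\<bar>\<theta>\<bar> ^ 3 / t ^ 4"] by simp
  qed
  finally show ?thesis .
qed

lemma mean_size_term_bounds:
  assumes "0 < t"
  shows "0 \<le> 1 / (2 * (cosh (real m * t) - 1))"
    and "1 / (2 * (cosh (real m * t) - 1)) \<le> 1 / t\<^sup>2 * (1 / real m ^ 2)"
proof -
  show "0 \<le> 1 / (2 * (cosh (real m * t) - 1))"
    using cosh_real_ge_1[of "real m * t"] by simp
  show "1 / (2 * (cosh (real m * t) - 1)) \<le> 1 / t\<^sup>2 * (1 / real m ^ 2)"
  proof (cases "m = 0")
    case False
    then have "1 / (2 * (cosh (real m * t) - 1)) \<le> 1 / (real m * t)\<^sup>2"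
      using cosh_minus_one_ge_square[of "real m * t"] cosh_minus_one_pos[of "real m * t"] assms
      by (intro divide_left_mono mult_pos_pos) auto
    then show ?thesis by (simp add: power_mult_distrib mult.commute)
  qed simp
qed

lemma summable_mean_size:
  assumes "0 < t"
  shows "summable (\<lambda>m. 1 / (2 * (cosh (real m * t) - 1)))"
proof (rule summable_comparison_test')
  show "summable (\<lambda>m. 1 / t\<^sup>2 * (1 / real m ^ 2))"
    using inverse_square_sums by (intro summable_mult) (rule sums_summable)
  show "norm (1 / (2 * (cosh (real m * t) - 1))) \<le> 1 / t\<^sup>2 * (1 / real m ^ 2)" for m
    using mean_size_term_bounds[OF assms, of m] by (simp only: real_norm_def abs_of_nonneg)
qed

lemma mean_size_le:
  assumes "0 < t"
  shows "mean_size t \<le> 329 / 200 / t\<^sup>2"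
proof -
  have "mean_size t \<le> 1 / t\<^sup>2 * (pi\<^sup>2 / 6)"
    unfolding mean_size_def
    by (rule sums_le[OF _ summable_sums[OF summable_mean_size[OF assms]] sums_mult[OF inverse_square_sums]])
       (rule mean_size_term_bounds[OF assms])
  also have "\<dots> \<le> 1 / t\<^sup>2 * (329 / 200)"
    using pi_square_sixth_le by (intro mult_left_mono) auto
  finally show ?thesis by simp
qed

lemma continuous_on_mean_size:
  assumes "0 < a"
  shows "continuous_on {a..b} mean_size"
proof -
  have "uniform_limit {a..b} (\<lambda>L t. \<Sum>m<L. 1 / (2 * (cosh (real m * t) - 1))) mean_size sequentially"
    unfolding mean_size_def
  proof (rule Weierstrass_m_test)
    show "summable (\<lambda>m. 1 / a\<^sup>2 * (1 / real m ^ 2))"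
      using inverse_square_sums by (intro summable_mult) (rule sums_summable)
    fix m t assume t: "t \<in> {a..b}"
    then have "0 < t" using assms by simp
    then have "1 / (2 * (cosh (real m * t) - 1)) \<le> 1 / t\<^sup>2 * (1 / real m ^ 2)"
      by (rule mean_size_term_bounds)
    also have "\<dots> \<le> 1 / a\<^sup>2 * (1 / real m ^ 2)"
      using t assms by (intro mult_right_mono divide_left_mono power_mono) auto
    finally show "norm (1 / (2 * (cosh (real m * t) - 1))) \<le> 1 / a\<^sup>2 * (1 / real m ^ 2)"
      using mean_size_term_bounds(1)[OF \<open>0 < t\<close>, of m] by (simp only: real_norm_def abs_of_nonneg)
  qed
  moreover have "continuous_on {a..b} (\<lambda>t. \<Sum>m<L. 1 / (2 * (cosh (real m * t) - 1)))" for L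
  proof (intro continuous_on_sum)
    fix m
    show "continuous_on {a..b} (\<lambda>t. 1 / (2 * (cosh (real m * t) - 1)))"
    proof (cases "m = 0")
      case False
      have "cosh (real m * t) - 1 \<noteq> 0" if "t \<in> {a..b}" for t
        using cosh_minus_one_pos[of "real m * t"] that assms False by auto
      then show ?thesis by (intro continuous_intros) auto
    qed simp
  qed
  ultimately show ?thesis
    by (intro uniform_limit_theorem[where F = sequentially]) auto
qed

text \<open>Intermediate values: at t = 1 / (2 x) the term m = 1 alone reaches x because cosh t - 1
  <= t there, and at t = 2 the whole sum is below 1.\<close>

lemma mean_size_surj:
  assumes "1 \<le> (x::real)"
  obtains t where "0 < t" "mean_size t = x"
proof -
  define a where "a = 1 / (2 * x)"
  have a: "0 < a" "a \<le> 1 / 2" using assms by (auto simp: a_def field_simps)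
  have "(cosh a - 1) * (1 - a\<^sup>2 / 4) \<le> a\<^sup>2 / 2" using a by (intro cosh_minus_one_le) auto
  moreover have "a\<^sup>2 / 2 \<le> a / 2" using a by (simp add: power2_eq_square)
  moreover have "(cosh a - 1) * (1 / 2) \<le> (cosh a - 1) * (1 - a\<^sup>2 / 4)"
    using a \<open>a\<^sup>2 / 2 \<le> a / 2\<close> cosh_real_ge_1[of a] by (intro mult_left_mono) auto
  ultimately have "(cosh a - 1) * (1 / 2) \<le> a / 2"
    by (meson order_trans)
  then have "cosh a - 1 \<le> a" by simp
  moreover have "0 < cosh a - 1" using a cosh_minus_one_pos by blast
  ultimately have "1 / (2 * a) \<le> 1 / (2 * (cosh (real 1 * a) - 1))"
    by (intro divide_left_mono) auto
  also have "\<dots> = (\<Sum>m\<in>{1}. 1 / (2 * (cosh (real m * a) - 1)))" by simp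
  also have "\<dots> \<le> mean_size a"
    unfolding mean_size_def using a
    by (intro sum_le_suminf summable_mean_size mean_size_term_bounds) auto
  finally have "x \<le> mean_size a" using assms by (simp add: a_def)
  moreover have "mean_size 2 \<le> x" using mean_size_le[of 2] assms by simp
  moreover have "a \<le> 2" using a by simp
  ultimately obtain t where "a \<le> t" "t \<le> 2" "mean_size t = x"
    using IVT2'[of mean_size 2 x a] continuous_on_mean_size[OF a(1), of 2] by blast
  then show ?thesis using a by (intro that[of t]) auto
qed

section \<open>The generating function in polar form\<close>

lemma lambert_term:
  assumes "0 < s"
  shows "of_real (exp (- s)) * cis \<psi> / (1 - of_real (exp (- s)) * cis \<psi>)
     = of_real (exp (- s)) / (1 - of_real (exp (- s)))
       + Complex (- damping s \<psi>) (phase s \<psi> + \<psi> / (2 * (cosh s - 1)))"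
proof -
  define \<rho> where "\<rho> = exp (- s)"
  define C c where "C = cosh s" and "c = cos \<psi>"
  have \<rho>: "0 < \<rho>" "\<rho> < 1" using assms by (simp_all add: \<rho>_def)
  have C: "1 < C" using cosh_minus_one_pos[OF assms] by (simp add: C_def)
  have c: "c \<le> 1" by (simp add: c_def)
  \<comment> \<open>This relation turns |1 - w|^2 into 2 \<rho> (cosh s - cos \<psi>) and carries
    the whole computation.\<close>
  have Csq: "\<rho>\<^sup>2 + 1 = 2 * \<rho> * C"
    by (simp add: \<rho>_def C_def cosh_def algebra_simps power2_eq_square flip: exp_add)
  have S: "sinh s = C - \<rho>"
    by (simp add: \<rho>_def C_def cosh_minus_sinh[symmetric])
  have den: "(1 - \<rho> * cos \<psi>)\<^sup>2 + (\<rho> * sin \<psi>)\<^sup>2 = 2 * \<rho> * (C - c)"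
  proof -
    have "(1 - \<rho> * cos \<psi>)\<^sup>2 + (\<rho> * sin \<psi>)\<^sup>2
        = 1 - 2 * \<rho> * c + (\<rho>\<^sup>2 * (sin \<psi>)\<^sup>2 + \<rho>\<^sup>2 * (cos \<psi>)\<^sup>2)"
      by (simp add: c_def power2_eq_square algebra_simps)
    also have "\<dots> = 2 * \<rho> * (C - c)"
      unfolding distrib_left[symmetric] using Csq by (simp add: algebra_simps)
    finally show ?thesis .
  qed
  have re: "\<rho> * c * (1 - \<rho> * c) - \<rho> * sin \<psi> * (\<rho> * sin \<psi>) = \<rho> * (c - \<rho>)"
  proof -
    have "\<rho> * c * (1 - \<rho> * c) - \<rho> * sin \<psi> * (\<rho> * sin \<psi>)
        = \<rho> * c - (\<rho>\<^sup>2 * (sin \<psi>)\<^sup>2 + \<rho>\<^sup>2 * (cos \<psi>)\<^sup>2)"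
      by (simp add: c_def power2_eq_square algebra_simps)
    also have "\<dots> = \<rho> * (c - \<rho>)"
      unfolding distrib_left[symmetric] by (simp add: power2_eq_square algebra_simps)
    finally show ?thesis .
  qed
  have "(c - \<rho>) / (2 * (C - c)) = (1 - \<rho>) / (2 * (C - 1)) - (C - \<rho>) * (1 - c) / (2 * (C - 1) * (C - c))"
  proof -
    have "a / (2 * y) = a * x / (2 * x * y)" if "x \<noteq> 0" for a x y :: real
      using that by simp
    from this[of "C - 1" "c - \<rho>" "C - c"]
    have "(c - \<rho>) / (2 * (C - c)) = (c - \<rho>) * (C - 1) / (2 * (C - 1) * (C - c))"
      using C by simp
    moreover have "(1 - \<rho>) / (2 * (C - 1)) = (1 - \<rho>) * (C - c) / (2 * (C - 1) * (C - c))"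
      using C c by simp
    moreover have "(c - \<rho>) * (C - 1) = (1 - \<rho>) * (C - c) - (C - \<rho>) * (1 - c)"
      by (simp add: algebra_simps)
    ultimately show ?thesis by (simp only: diff_divide_distrib)
  qed
  moreover have "\<rho> / (1 - \<rho>) = (1 - \<rho>) / (2 * (C - 1))"
  proof -
    have "\<rho> * (2 * (C - 1)) = (1 - \<rho>) * (1 - \<rho>)"
      using Csq by (simp add: algebra_simps power2_eq_square)
    then show ?thesis using C \<rho> by (simp add: frac_eq_eq)
  qed
  ultimately have R: "\<rho> * (c - \<rho>) / (2 * \<rho> * (C - c)) = \<rho> / (1 - \<rho>) - damping s \<psi>"
    using \<rho> by (simp add: damping_def S flip: C_def c_def)
  have "Re (of_real \<rho> * cis \<psi> / (1 - of_real \<rho> * cis \<psi>))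
      = (\<rho> * c * (1 - \<rho> * c) - \<rho> * sin \<psi> * (\<rho> * sin \<psi>)) / ((1 - \<rho> * cos \<psi>)\<^sup>2 + (\<rho> * sin \<psi>)\<^sup>2)"
    by (simp add: Re_divide c_def)
  then have 1: "Re (of_real \<rho> * cis \<psi> / (1 - of_real \<rho> * cis \<psi>)) = \<rho> / (1 - \<rho>) - damping s \<psi>"
    by (simp only: re den R)
  have "Im (of_real \<rho> * cis \<psi> / (1 - of_real \<rho> * cis \<psi>))
      = (\<rho> * sin \<psi> * (1 - \<rho> * cos \<psi>) + \<rho> * cos \<psi> * (\<rho> * sin \<psi>)) / ((1 - \<rho> * cos \<psi>)\<^sup>2 + (\<rho> * sin \<psi>)\<^sup>2)"
    by (simp add: Im_divide)
  also have "\<rho> * sin \<psi> * (1 - \<rho> * cos \<psi>) + \<rho> * cos \<psi> * (\<rho> * sin \<psi>) = \<rho> * sin \<psi>"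
    by (simp add: algebra_simps)
  finally have 2: "Im (of_real \<rho> * cis \<psi> / (1 - of_real \<rho> * cis \<psi>)) = phase s \<psi> + \<psi> / (2 * (cosh s - 1))"
    unfolding den using \<rho> by (simp add: phase_def C_def c_def)
  have 3: "complex_of_real \<rho> / (1 - of_real \<rho>) = of_real (\<rho> / (1 - \<rho>))" by simp
  show ?thesis
    unfolding \<rho>_def[symmetric] 3
    by (rule complex_eqI) (simp_all only: 1 2 plus_complex.sel complex.sel Re_complex_of_real Im_complex_of_real
         add_0 add_uminus_conv_diff)
qed

lemma log_gf_of_real:
  assumes "0 < t"
  shows "(\<lambda>m. of_real (exp (- t)) ^ m / (1 - of_real (exp (- t)) ^ m) / of_nat m)
           sums log_gf (of_real (exp (- t)))"
    and "Im (log_gf (of_real (exp (- t)))) = 0"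
proof -
  define r where "r = exp (- t)"
  have r: "0 < r" "r < 1" using assms by (simp_all add: r_def)
  have "summable (\<lambda>m. r ^ m / (1 - r ^ m) / real m)"
  proof (rule summable_comparison_test')
    show "summable (\<lambda>m. r ^ m * (1 / (1 - r)))"
      using r by (intro summable_mult2 summable_geometric) auto
    show "norm (r ^ m / (1 - r ^ m) / real m) \<le> r ^ m * (1 / (1 - r))" for m
    proof (cases "m = 0")
      case False
      have "r ^ m \<le> r ^ 1" using r False by (intro power_decreasing) auto
      then have *: "1 - r \<le> 1 - r ^ m" by simp
      have "norm (r ^ m / (1 - r ^ m) / real m) = r ^ m / ((1 - r ^ m) * real m)"
        using r * by (simp add: abs_mult)
      also have "\<dots> \<le> r ^ m / ((1 - r) * 1)"
        using r * False by (intro divide_left_mono mult_mono) auto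
      finally show ?thesis by simp
    qed (use r in simp)
  qed
  then have "(\<lambda>m. complex_of_real (r ^ m / (1 - r ^ m) / real m)) sums of_real (\<Sum>m. r ^ m / (1 - r ^ m) / real m)"
    by (intro sums_of_real summable_sums)
  then have *: "(\<lambda>m. of_real r ^ m / (1 - of_real r ^ m) / of_nat m) sums complex_of_real (\<Sum>m. r ^ m / (1 - r ^ m) / real m)"
    by simp
  then show "(\<lambda>m. of_real (exp (- t)) ^ m / (1 - of_real (exp (- t)) ^ m) / of_nat m)
           sums log_gf (of_real (exp (- t)))"
    unfolding log_gf_def r_def[symmetric] by (simp add: sums_iff)
  show "Im (log_gf (of_real (exp (- t)))) = 0"
    using * unfolding log_gf_def r_def[symmetric] by (simp add: sums_iff)
qed

lemma log_gf_polar: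
  assumes "0 < t"
  shows "log_gf (of_real (exp (- t)) * cis \<theta>) = log_gf (of_real (exp (- t)))
     + Complex (- total_damping t \<theta>) (total_phase t \<theta> + mean_size t * \<theta>)"
proof -
  let ?z = "of_real (exp (- t)) * cis \<theta>"
  have term_eq: "?z ^ m / (1 - ?z ^ m) / of_nat m
      = of_real (exp (- t)) ^ m / (1 - of_real (exp (- t)) ^ m) / of_nat m
        + Complex (- (damping (real m * t) (real m * \<theta>) / real m))
           (phase (real m * t) (real m * \<theta>) / real m + 1 / (2 * (cosh (real m * t) - 1)) * \<theta>)" for m
  proof (cases "m = 0")
    case False
    have "?z ^ m = of_real (exp (- (real m * t))) * cis (real m * \<theta>)"
      by (simp add: power_mult_distrib Complex.DeMoivre flip: of_real_power exp_of_nat_mult)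
    moreover have "complex_of_real (exp (- t)) ^ m = of_real (exp (- (real m * t)))"
      by (simp flip: of_real_power exp_of_nat_mult)
    ultimately have "?z ^ m / (1 - ?z ^ m) / of_nat m
      = (of_real (exp (- t)) ^ m / (1 - of_real (exp (- t)) ^ m)
        + Complex (- damping (real m * t) (real m * \<theta>))
           (phase (real m * t) (real m * \<theta>) + real m * \<theta> / (2 * (cosh (real m * t) - 1)))) / of_nat m"
      using lambert_term[of "real m * t" "real m * \<theta>"] False assms by simp
    also have "\<dots> = of_real (exp (- t)) ^ m / (1 - of_real (exp (- t)) ^ m) / of_nat m
        + Complex (- damping (real m * t) (real m * \<theta>))
           (phase (real m * t) (real m * \<theta>) + real m * \<theta> / (2 * (cosh (real m * t) - 1))) / of_nat m"
      by (rule add_divide_distrib)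
    also have "Complex (- damping (real m * t) (real m * \<theta>))
           (phase (real m * t) (real m * \<theta>) + real m * \<theta> / (2 * (cosh (real m * t) - 1))) / of_nat m
        = Complex (- (damping (real m * t) (real m * \<theta>) / real m))
           (phase (real m * t) (real m * \<theta>) / real m + 1 / (2 * (cosh (real m * t) - 1)) * \<theta>)"
      using False by (simp add: complex_eq_iff Re_divide_of_nat Im_divide_of_nat add_divide_distrib)
    finally show ?thesis .
  qed (simp add: complex_eq_iff)
  have "(\<lambda>m. ?z ^ m / (1 - ?z ^ m) / of_nat m) sums (log_gf (of_real (exp (- t)))
     + Complex (- total_damping t \<theta>) (total_phase t \<theta> + mean_size t * \<theta>))"
    unfolding term_eq
  proof (intro sums_add log_gf_of_real(1) assms)
    have "(\<lambda>m. - (damping (real m * t) (real m * \<theta>) / real m)) sums (- total_damping t \<theta>)"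
      unfolding total_damping_def by (intro sums_minus summable_sums summable_damping assms)
    moreover have "(\<lambda>m. phase (real m * t) (real m * \<theta>) / real m + 1 / (2 * (cosh (real m * t) - 1)) * \<theta>)
       sums (total_phase t \<theta> + mean_size t * \<theta>)"
      unfolding total_phase_def mean_size_def
      by (intro sums_add sums_mult2 summable_sums summable_mean_size assms
            summable_rabs_cancel[OF summable_phase])
    ultimately show "(\<lambda>m. Complex (- (damping (real m * t) (real m * \<theta>) / real m))
           (phase (real m * t) (real m * \<theta>) / real m + 1 / (2 * (cosh (real m * t) - 1)) * \<theta>))
       sums Complex (- total_damping t \<theta>) (total_phase t \<theta> + mean_size t * \<theta>)"
      by (simp add: sums_complex_iff)
  qed
  then show ?thesis by (simp add: log_gf_def sums_iff)
qed

text \<open>\<open>t\<close> and \<open>N\<close> are independent, so one saddle point can serve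
  neighbouring coefficients; a change of \<open>N\<close> only adds a linear phase.\<close>

lemma partition_count_saddle_integral:
  assumes "0 < t"
  defines "E \<equiv> exp (Re (log_gf (of_real (exp (- t)))))"
  shows "((\<lambda>\<theta>. exp (- total_damping t \<theta>) * cos (total_phase t \<theta> + (mean_size t - real N) * \<theta>))
     has_integral (pi * real (partition_count N) * exp (- t) ^ N / E)) {0..pi}"
proof -
  have eq: "Re (exp (log_gf (of_real (exp (- t)) * cis \<theta>)) * cis (- real N * \<theta>)) / E
      = exp (- total_damping t \<theta>) * cos (total_phase t \<theta> + (mean_size t - real N) * \<theta>)" for \<theta>
  proof -
    have "log_gf (of_real (exp (- t))) = of_real (Re (log_gf (of_real (exp (- t)))))"
      using log_gf_of_real(2)[OF assms(1)] by (simp add: complex_eq_iff)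
    then have "exp (log_gf (of_real (exp (- t)))) = of_real E"
      unfolding E_def by (metis exp_of_real)
    moreover have "exp (Complex (- total_damping t \<theta>) (total_phase t \<theta> + mean_size t * \<theta>))
        = of_real (exp (- total_damping t \<theta>)) * cis (total_phase t \<theta> + mean_size t * \<theta>)"
      by (simp add: exp_eq_polar)
    ultimately have "exp (log_gf (of_real (exp (- t)) * cis \<theta>)) * cis (- real N * \<theta>)
        = of_real (E * exp (- total_damping t \<theta>)) *
          (cis (total_phase t \<theta> + mean_size t * \<theta>) * cis (- real N * \<theta>))"
      unfolding log_gf_polar[OF assms(1)] exp_add by simp
    also have "cis (total_phase t \<theta> + mean_size t * \<theta>) * cis (- real N * \<theta>)
        = cis (total_phase t \<theta> + (mean_size t - real N) * \<theta>)"
      by (simp add: cis_mult algebra_simps)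
    finally show ?thesis by (simp add: E_def)
  qed
  have "((\<lambda>\<theta>. Re (exp (log_gf (of_real (exp (- t)) * cis \<theta>)) * cis (- real N * \<theta>)) / E)
     has_integral (pi * real (partition_count N) * exp (- t) ^ N / E)) {0..pi}"
    using assms(1) by (intro has_integral_divide partition_count_has_integral) auto
  then show ?thesis unfolding eq .
qed

section \<open>Bounds for the integrals\<close>

lemma half_gaussian_moment:
  fixes \<alpha> :: real
  assumes "0 < \<alpha>"
  shows "((\<lambda>x. exp (- (\<alpha> * x\<^sup>2)) * x ^ (2 * k)) has_integral
     (sqrt pi / 2 * (fact (2 * k) / (2 ^ (2 * k) * fact k)) / sqrt \<alpha> ^ (2 * k + 1))) {0..}"
proof -
  define I where "I = sqrt pi / 2 * (fact (2 * k) / (2 ^ (2 * k) * fact k))"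
  let ?f = "\<lambda>x. if x \<in> {0..} then exp (- (\<alpha> * x\<^sup>2)) * x ^ (2 * k) else 0"
  have "has_bochner_integral lborel (\<lambda>x. indicator {0..} x *\<^sub>R (exp (- x\<^sup>2) * x ^ (2 * k))) I"
    unfolding I_def by (rule gaussian_moment_even_pos)
  then have "has_bochner_integral lborel
      (\<lambda>x. indicator {0..} (0 + sqrt \<alpha> * x) *\<^sub>R (exp (- (0 + sqrt \<alpha> * x)\<^sup>2) * (0 + sqrt \<alpha> * x) ^ (2 * k)))
      (I /\<^sub>R \<bar>sqrt \<alpha>\<bar>)"
    using assms by (subst (asm) lborel_has_bochner_integral_real_affine_iff[where c = "sqrt \<alpha>" and t = 0]) auto
  moreover have "(\<lambda>x. indicator {0..} (0 + sqrt \<alpha> * x) *\<^sub>R (exp (- (0 + sqrt \<alpha> * x)\<^sup>2) * (0 + sqrt \<alpha> * x) ^ (2 * k)))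
      = (\<lambda>x. ?f x * sqrt \<alpha> ^ (2 * k))"
    using assms by (auto simp: fun_eq_iff indicator_def zero_le_mult_iff power_mult_distrib)
  moreover have "I /\<^sub>R \<bar>sqrt \<alpha>\<bar> = I / sqrt \<alpha>"
    using assms by (simp add: divide_inverse)
  ultimately have bochner: "has_bochner_integral lborel (\<lambda>x. ?f x * sqrt \<alpha> ^ (2 * k)) (I / sqrt \<alpha>)"
    by metis
  have "((\<lambda>x. ?f x * sqrt \<alpha> ^ (2 * k)) has_integral (I / sqrt \<alpha>)) UNIV"
    using has_integral_integral_lborel[OF bochner[THEN integrable.intros]]
    unfolding has_bochner_integral_integral_eq[OF bochner] .
  then have "((\<lambda>x. ?f x * sqrt \<alpha> ^ (2 * k) / sqrt \<alpha> ^ (2 * k))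
      has_integral (I / sqrt \<alpha> / sqrt \<alpha> ^ (2 * k))) UNIV"
    by (rule has_integral_divide)
  moreover have "(\<lambda>x. ?f x * sqrt \<alpha> ^ (2 * k) / sqrt \<alpha> ^ (2 * k)) = ?f"
    using assms by simp
  moreover have "I / sqrt \<alpha> / sqrt \<alpha> ^ (2 * k) = I / sqrt \<alpha> ^ (2 * k + 1)"
    by simp
  ultimately have "(?f has_integral (I / sqrt \<alpha> ^ (2 * k + 1))) UNIV"
    by metis
  then show ?thesis unfolding I_def by (simp only: has_integral_restrict_UNIV)
qed

lemma has_integral_power_piece:
  fixes l r b :: real
  assumes "0 \<le> l" "l \<le> r" "r \<le> b"
  shows "((\<lambda>x. if x \<in> {l..r} then x ^ j else 0) has_integral
     ((r ^ Suc j - l ^ Suc j) / real (Suc j))) {0..b}"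
proof -
  have "((\<lambda>x. x ^ j) has_integral (r ^ Suc j / real (Suc j) - l ^ Suc j / real (Suc j))) {l..r}"
  proof (rule fundamental_theorem_of_calculus[OF assms(2)])
    fix x
    have "((\<lambda>x. x ^ Suc j / real (Suc j)) has_real_derivative x ^ j) (at x within {l..r})"
      by (rule DERIV_cong[OF DERIV_cdivide[OF DERIV_pow]]) (simp del: of_nat_Suc)
    then show "((\<lambda>x. x ^ Suc j / real (Suc j)) has_vector_derivative x ^ j) (at x within {l..r})"
      by (simp only: has_real_derivative_iff_has_vector_derivative)
  qed
  then have "((\<lambda>x. x ^ j) has_integral ((r ^ Suc j - l ^ Suc j) / real (Suc j))) {l..r}"
    by (simp only: diff_divide_distrib)
  moreover have "{l..r} \<subseteq> {0..b}" using assms by auto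
  ultimately show ?thesis by (subst has_integral_restrict) auto
qed

lemma exp_ge_cubic:
  assumes "0 \<le> (x::real)"
  shows "1 + x + x\<^sup>2 / 2 + x ^ 3 / 6 \<le> exp x"
proof -
  have "(\<Sum>n<4. x ^ n /\<^sub>R fact n) \<le> (\<Sum>n. x ^ n /\<^sub>R fact n)"
    using assms summable_exp_generic[of x] by (intro sum_le_suminf) auto
  also have "\<dots> = exp x" using exp_converges[of x] by (simp add: sums_iff)
  finally show ?thesis
    by (simp add: lessThan_nat_numeral fact_numeral field_simps)
qed

text \<open>The function exp (- E / t) / t^k increases up to t = E / k. An exponentially small
  factor is thereby traded for a power of t, with the constant read off at the largest admissible
  t.\<close>

lemma exp_neg_le_power:
  fixes E t\<^sub>0 :: real
  assumes "0 < t" "t \<le> t\<^sub>0" "real k * t\<^sub>0 \<le> E"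
  shows "exp (- (E / t)) \<le> exp (- (E / t\<^sub>0)) * (t / t\<^sub>0) ^ k"
proof -
  have t0: "0 < t\<^sub>0" using assms by linarith
  have "(t\<^sub>0 / t) ^ k \<le> exp (t\<^sub>0 / t - 1) ^ k"
    using assms t0 exp_ge_add_one_self[of "t\<^sub>0 / t - 1"] by (intro power_mono) auto
  also have "\<dots> = exp (real k * (t\<^sub>0 / t - 1))" by (simp add: exp_of_nat_mult)
  also have "\<dots> \<le> exp (E / t\<^sub>0 * (t\<^sub>0 / t - 1))"
  proof -
    have "real k \<le> E / t\<^sub>0" using assms t0 by (simp add: field_simps)
    moreover have "0 \<le> t\<^sub>0 / t - 1" using assms by (simp add: field_simps)
    ultimately show ?thesis unfolding exp_le_cancel_iff by (rule mult_right_mono)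
  qed
  also have "E / t\<^sub>0 * (t\<^sub>0 / t - 1) = E / t - E / t\<^sub>0"
    using t0 by (simp add: field_simps)
  finally have *: "(t\<^sub>0 / t) ^ k \<le> exp (E / t) * exp (- (E / t\<^sub>0))"
    by (simp add: exp_diff exp_minus divide_inverse)
  have "exp (- (E / t)) * ((t\<^sub>0 / t) ^ k * (t / t\<^sub>0) ^ k)
      \<le> exp (- (E / t)) * ((exp (E / t) * exp (- (E / t\<^sub>0))) * (t / t\<^sub>0) ^ k)"
    using * assms t0 by (intro mult_left_mono mult_right_mono) auto
  moreover have "(t\<^sub>0 / t) ^ k * (t / t\<^sub>0) ^ k = 1"
    using assms t0 by (simp flip: power_mult_distrib)
  moreover have "exp (- (E / t)) * ((exp (E / t) * exp (- (E / t\<^sub>0))) * (t / t\<^sub>0) ^ k)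
      = exp (- (E / t\<^sub>0)) * (t / t\<^sub>0) ^ k"
    by (simp add: exp_minus)
  ultimately show ?thesis by simp
qed

text \<open>Only the first six terms of the damping series are used; for angles beyond \<open>\<pi> / 6\<close>, where
  they are no longer all increasing, the first term alone is already large enough.\<close>

lemma total_damping_ge_near:
  assumes t: "0 < t" "t \<le> 1 / 22" and u: "0 \<le> u" "u \<le> 7 / 5" and \<theta>: "u * t \<le> \<theta>" "\<theta> \<le> pi / 6"
  shows "14913 / 10000 * (u\<^sup>2 / (u\<^sup>2 + 26 / 25)) / t \<le> total_damping t \<theta>"
proof -
  define c where "c = u\<^sup>2 / (u\<^sup>2 + 26 / 25)"
  have c: "0 \<le> c" by (simp add: c_def)
  have "1 / (real m ^ 2 * t) * c \<le> damping (real m * t) (real m * \<theta>) / real m" if m: "m \<in> {1..6}" for m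
  proof -
    \<comment> \<open>This q makes q / (1 + q) equal to \<open>c\<close>. The 4 percent in 26/25
      absorb the errors of the expansions: 484/475 for cosh and
      \<open>1 - ?\<psi>\<^sub>0\<^sup>2 / 12\<close> for the cosine.\<close>
    let ?s = "real m * t" and ?\<psi>\<^sub>0 = "real m * (u * t)" and ?q = "25 / 26 * u\<^sup>2"
    have s: "0 < ?s" "?s \<le> 3 / 11"
      using m t mult_mono[of "real m" 6 t "1 / 22"] by auto
    have s2: "?s\<^sup>2 \<le> 9 / 121"
      using power_mono[OF s(2), of 2] s(1) by (simp add: power2_eq_square)
    have us: "?\<psi>\<^sub>0 = u * ?s" by simp
    have u2: "u\<^sup>2 \<le> 49 / 25"
      using power_mono[OF u(2), of 2] u(1) by (simp add: power2_eq_square)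
    have \<psi>2: "?\<psi>\<^sub>0\<^sup>2 \<le> 49 / 25 * (9 / 121)"
      unfolding us power_mult_distrib[of u "real m * t"] using u2 s2 by (intro mult_mono) auto
    have "(cosh ?s - 1) * (1 - ?s\<^sup>2 / 4) \<le> ?s\<^sup>2 / 2"
      using s by (intro cosh_minus_one_le) auto
    moreover have "(cosh ?s - 1) * (475 / 484) \<le> (cosh ?s - 1) * (1 - ?s\<^sup>2 / 4)"
      using s2 cosh_real_ge_1[of ?s] by (intro mult_left_mono) auto
    ultimately have "(cosh ?s - 1) * (475 / 484) \<le> ?s\<^sup>2 / 2" by (meson order_trans)
    then have K: "cosh ?s - 1 \<le> 484 / 475 * (?s\<^sup>2 / 2)" by (simp add: field_simps)
    have "(cosh ?s - 1) * ?q \<le> 484 / 475 * (?s\<^sup>2 / 2) * ?q"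
      using K by (intro mult_right_mono) auto
    also have "\<dots> = 484 / 475 * (25 / 26) * (?\<psi>\<^sub>0\<^sup>2 / 2)"
      unfolding us by (simp add: power_mult_distrib)
    also have "\<dots> \<le> (1 - ?\<psi>\<^sub>0\<^sup>2 / 12) * (?\<psi>\<^sub>0\<^sup>2 / 2)"
      using \<psi>2 by (intro mult_right_mono) auto
    also have "\<dots> = ?\<psi>\<^sub>0\<^sup>2 / 2 - ?\<psi>\<^sub>0 ^ 4 / 24"
      by (simp add: field_simps power2_eq_square power4_eq_xxxx)
    finally have q: "(cosh ?s - 1) * ?q \<le> ?\<psi>\<^sub>0\<^sup>2 / 2 - ?\<psi>\<^sub>0 ^ 4 / 24" .
    have "real m * \<theta> \<le> 6 * (pi / 6)"
      using m \<theta> u t by (intro mult_mono) (auto intro: order_trans[OF mult_nonneg_nonneg \<theta>(1)])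
    then have d: "1 / ?s * (?q / (1 + ?q)) \<le> damping ?s (real m * \<theta>)"
      using s u t \<theta> \<psi>2 q m by (intro damping_ge[where \<psi>\<^sub>0 = ?\<psi>\<^sub>0]) (auto intro: mult_left_mono)
    have "0 < u\<^sup>2 + 26 / 25" by (simp add: add_nonneg_pos)
    then have e: "?q / (1 + ?q) = c" by (simp add: c_def field_simps)
    have "1 / ?s * c / real m \<le> damping ?s (real m * \<theta>) / real m"
      using d[unfolded e] by (rule divide_right_mono) simp
    then show ?thesis by (simp add: power2_eq_square mult.commute mult.left_commute)
  qed
  then have "(\<Sum>m=1..6. 1 / (real m ^ 2 * t) * c) \<le> (\<Sum>m=1..6. damping (real m * t) (real m * \<theta>) / real m)"
    by (rule sum_mono)
  also have "\<dots> \<le> total_damping t \<theta>" using t by (intro sum_damping_le_total) auto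
  \<comment> \<open>5369/3600 is the sum of 1 / m^2 for m up to 6; 14913/10000 rounds it
    down.\<close>
  also have "(\<Sum>m=1..6. 1 / (real m ^ 2 * t) * c) = (5369 / 3600) * (c / t)"
    using t by (simp add: numeral_eq_Suc)
  finally have "5369 / 3600 * (c / t) \<le> total_damping t \<theta>" .
  moreover have "14913 / 10000 * (c / t) \<le> 5369 / 3600 * (c / t)"
    using c t by (intro mult_right_mono) auto
  moreover have "14913 / 10000 * c / t = 14913 / 10000 * (c / t)" by simp
  ultimately show ?thesis unfolding c_def[symmetric] by linarith
qed

lemma total_damping_ge_far:
  assumes t: "0 < t" "t \<le> 1 / 22" and \<theta>: "1 / 2 \<le> \<theta>" "\<theta> \<le> pi"
  shows "99 / 100 / t \<le> total_damping t \<theta>"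
proof -
  have t2: "t\<^sup>2 \<le> 1 / 484" using power_mono[OF t(2), of 2] t(1) by (simp add: power2_eq_square)
  have "(cosh t - 1) * (1 - t\<^sup>2 / 4) \<le> t\<^sup>2 / 2" using t by (intro cosh_minus_one_le) auto
  moreover have "(cosh t - 1) * (19 / 20) \<le> (cosh t - 1) * (1 - t\<^sup>2 / 4)"
    using t2 cosh_real_ge_1[of t] by (intro mult_left_mono) auto
  ultimately have "(cosh t - 1) * (19 / 20) \<le> t\<^sup>2 / 2" by (meson order_trans)
  then have "cosh t - 1 \<le> 20 / 19 * (t\<^sup>2 / 2)" by (simp add: field_simps)
  \<comment> \<open>The target is q = 99, for which q / (1 + q) = 99/100; 47/384 is x^2 / 2 - x^4 /
    24 at x = 1/2, an angle just below \<pi> / 6.\<close>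
  then have "(cosh t - 1) * 99 \<le> 47 / 384" using t2 by simp
  then have "(cosh t - 1) * 99 \<le> (1 / 2)\<^sup>2 / 2 - (1 / 2) ^ 4 / 24"
    by (simp add: power2_eq_square power4_eq_xxxx)
  then have "1 / t * (99 / (1 + 99)) \<le> damping t \<theta>"
    using t \<theta> by (intro damping_ge[where \<psi>\<^sub>0 = "1 / 2"]) (auto simp: power2_eq_square)
  also have "damping t \<theta> = (\<Sum>m\<in>{1}. damping (real m * t) (real m * \<theta>) / real m)" by simp
  also have "\<dots> \<le> total_damping t \<theta>" using t by (intro sum_damping_le_total) auto
  finally show ?thesis by simp
qed

lemma total_damping_ge:
  assumes t: "0 < t" "t \<le> 1 / 22" and u: "0 \<le> u" "u \<le> 7 / 5" and \<theta>: "u * t \<le> \<theta>" "\<theta> \<le> pi"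
    and E: "E * (u\<^sup>2 + 26 / 25) \<le> 14913 / 10000 * u\<^sup>2" "E \<le> 99 / 100"
  shows "E / t \<le> total_damping t \<theta>"
proof (cases "\<theta> \<le> pi / 6")
  case True
  have "0 < u\<^sup>2 + 26 / 25" by (simp add: add_nonneg_pos)
  then have "E \<le> 14913 / 10000 * (u\<^sup>2 / (u\<^sup>2 + 26 / 25))"
    using E(1) by (simp add: field_simps)
  then have "E / t \<le> 14913 / 10000 * (u\<^sup>2 / (u\<^sup>2 + 26 / 25)) / t"
    using t by (intro divide_right_mono) auto
  then show ?thesis
    using total_damping_ge_near[OF t u \<theta>(1) True] by linarith
next
  case False
  then have "1 / 2 \<le> \<theta>" using pi_gt3 by linarith
  then have "99 / 100 / t \<le> total_damping t \<theta>" by (intro total_damping_ge_far t \<theta>)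
  moreover have "E / t \<le> 99 / 100 / t" using E t by (intro divide_right_mono) auto
  ultimately show ?thesis by linarith
qed

text \<open>With u = \<theta> / t the claim needs 6/5 (u^2 + 26/25) <= 1.4913, that is u^2 <=
  0.20275, and (9/20)^2 = 0.2025 nearly exhausts this.\<close>

lemma total_damping_ge_quadratic:
  assumes t: "0 < t" "t \<le> 1 / 22" and \<theta>: "0 \<le> \<theta>" "\<theta> \<le> 9 / 20 * t"
  shows "6 / 5 * \<theta>\<^sup>2 / t ^ 3 \<le> total_damping t \<theta>"
proof -
  define u where "u = \<theta> / t"
  have u: "0 \<le> u" "u \<le> 9 / 20" "u * t = \<theta>" using t \<theta> by (auto simp: u_def field_simps)
  have u2: "u\<^sup>2 \<le> 81 / 400" using power_mono[OF u(2), of 2] u(1) by (simp add: power2_eq_square)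
  have "6 / 5 * \<theta>\<^sup>2 / t ^ 3 = 6 / 5 * u\<^sup>2 / t"
    using t by (simp add: u_def field_simps power2_eq_square power3_eq_cube)
  also have "\<dots> \<le> total_damping t \<theta>"
  proof (rule total_damping_ge[where u = u])
    have "u\<^sup>2 * (6 / 5 * (u\<^sup>2 + 26 / 25)) \<le> u\<^sup>2 * (14913 / 10000)"
      using u2 by (intro mult_left_mono) auto
    then show "6 / 5 * u\<^sup>2 * (u\<^sup>2 + 26 / 25) \<le> 14913 / 10000 * u\<^sup>2"
      by (simp add: algebra_simps)
    show "\<theta> \<le> pi" using \<theta> t pi_gt3 by linarith
  qed (use u u2 t in auto)
  finally show ?thesis .
qed

text \<open>Beyond \<open>9 t / 20\<close> the Gaussian majorant of \<open>|h|\<close> is replaced by a step function; \<open>rate i / t\<close> is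
  the damping guaranteed to the right of \<open>cut t i\<close>.\<close>

definition cut :: "real \<Rightarrow> nat \<Rightarrow> real" where
  "cut t i = [9 / 20 * t, 11 / 20 * t, 7 / 10 * t, 7 / 5 * t, pi] ! i"

definition rate :: "nat \<Rightarrow> real" where
  "rate i = [243 / 1000, 336 / 1000, 477 / 1000, 97 / 100] ! i"

definition tail :: "real \<Rightarrow> nat \<Rightarrow> real \<Rightarrow> real" where
  "tail t j \<theta> = (\<Sum>i<4. exp (- (rate i / t)) * (if \<theta> \<in> {cut t i..cut t (Suc i)} then \<theta> ^ j else 0))"

section \<open>Gaussian and step function bounds for the integrands\<close>

lemma half_gaussian_moment_upto:
  fixes \<alpha> b :: real
  assumes "0 < \<alpha>"
  shows "(\<lambda>x. exp (- (\<alpha> * x\<^sup>2)) * x ^ (2 * k)) integrable_on {0..b}"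
    and "integral {0..b} (\<lambda>x. exp (- (\<alpha> * x\<^sup>2)) * x ^ (2 * k))
      \<le> sqrt pi / 2 * (fact (2 * k) / (2 ^ (2 * k) * fact k)) * (1 / sqrt \<alpha>) ^ (2 * k + 1)"
proof -
  show *: "(\<lambda>x. exp (- (\<alpha> * x\<^sup>2)) * x ^ (2 * k)) integrable_on {0..b}"
    by (intro integrable_continuous_real continuous_intros)
  have "integral {0..b} (\<lambda>x. exp (- (\<alpha> * x\<^sup>2)) * x ^ (2 * k))
      \<le> sqrt pi / 2 * (fact (2 * k) / (2 ^ (2 * k) * fact k)) / sqrt \<alpha> ^ (2 * k + 1)"
    by (rule has_integral_subset_le[OF _ integrable_integral[OF *] half_gaussian_moment[OF assms]])
       (auto intro!: mult_nonneg_nonneg zero_le_power)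
  then show "integral {0..b} (\<lambda>x. exp (- (\<alpha> * x\<^sup>2)) * x ^ (2 * k))
      \<le> sqrt pi / 2 * (fact (2 * k) / (2 ^ (2 * k) * fact k)) * (1 / sqrt \<alpha>) ^ (2 * k + 1)"
    by (simp add: power_divide)
qed

lemma sqrt_pi_bounds: "17724 / 10000 \<le> sqrt pi" "sqrt pi \<le> 17725 / 10000"
proof -
  show "17724 / 10000 \<le> sqrt pi"
    by (rule real_le_rsqrt) (use pi_approx in \<open>simp add: power2_eq_square\<close>)
  show "sqrt pi \<le> 17725 / 10000"
    by (rule real_le_lsqrt) (use pi_approx in \<open>simp_all add: power2_eq_square\<close>)
qed

text \<open>Beyond \<pi> one has 1 <= x^2, so the part cut off is at most the second moment.\<close>

lemma half_gaussian_ge: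
  fixes \<alpha> :: real
  assumes "0 < \<alpha>"
  shows "sqrt pi / 2 * (1 / sqrt \<alpha>) - (1 / sqrt \<alpha>) ^ 3 \<le> integral {0..pi} (\<lambda>x. exp (- (\<alpha> * x\<^sup>2)))"
proof -
  let ?f = "\<lambda>x. exp (- (\<alpha> * x\<^sup>2))"
  have f: "(?f has_integral (sqrt pi / 2 * (1 / sqrt \<alpha>))) {0..}"
    using half_gaussian_moment[OF assms, of 0] by simp
  have g: "((\<lambda>x. ?f x * x\<^sup>2) has_integral (sqrt pi / 4 * (1 / sqrt \<alpha>) ^ 3)) {0..}"
    using half_gaussian_moment[OF assms, of 1] by (simp add: fact_2 numeral_3_eq_3 power_divide)
  have i: "?f integrable_on {0..pi}"
    by (intro integrable_continuous_real continuous_intros)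
  then have "((\<lambda>x. if x \<in> {0..pi} then ?f x else 0) has_integral integral {0..pi} ?f) {0..}"
    by (subst has_integral_restrict) auto
  then have "((\<lambda>x. (if x \<in> {0..pi} then ?f x else 0) + ?f x * x\<^sup>2)
      has_integral (integral {0..pi} ?f + sqrt pi / 4 * (1 / sqrt \<alpha>) ^ 3)) {0..}"
    by (intro has_integral_add g)
  then have "sqrt pi / 2 * (1 / sqrt \<alpha>) \<le> integral {0..pi} ?f + sqrt pi / 4 * (1 / sqrt \<alpha>) ^ 3"
  proof (rule has_integral_le[OF f])
    fix x :: real
    have "1 \<le> x\<^sup>2" if "pi < x" using that pi_gt3 by (intro one_le_power) auto
    then show "?f x \<le> (if x \<in> {0..pi} then ?f x else 0) + ?f x * x\<^sup>2" if "x \<in> {0..}"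
      using that by (auto simp: not_le mult_le_cancel_left1)
  qed
  moreover have "sqrt pi / 4 * (1 / sqrt \<alpha>) ^ 3 \<le> 1 * (1 / sqrt \<alpha>) ^ 3"
    using sqrt_pi_bounds assms by (intro mult_right_mono) auto
  ultimately show ?thesis by simp
qed

context
  fixes t :: real
  assumes t: "0 < t" "t \<le> 1 / 22"
begin

lemma cut_bounds:
  assumes "i < 4"
  shows "0 \<le> cut t i" "cut t i \<le> cut t (Suc i)" "cut t (Suc i) \<le> pi"
proof -
  have "i = 0 \<or> i = 1 \<or> i = 2 \<or> i = 3" using assms by linarith
  moreover have "7 / 5 * t \<le> pi" using t pi_gt3 by linarith
  ultimately show "0 \<le> cut t i" "cut t i \<le> cut t (Suc i)" "cut t (Suc i) \<le> pi"
    using t by (auto simp: cut_def numeral_eq_Suc)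
qed

text \<open>The rates are 1.4913 u^2 / (u^2 + 26/25), rounded down, at u = 9/20, 11/20, 7/10 and
  7/5.\<close>

lemma rate_le_damping:
  assumes "i < 4" "cut t i \<le> \<theta>" "\<theta> \<le> pi"
  shows "rate i / t \<le> total_damping t \<theta>"
proof -
  have "i = 0 \<or> i = 1 \<or> i = 2 \<or> i = 3" using assms by linarith
  then consider "i = 0" | "i = 1" | "i = 2" | "i = 3" by blast
  then show ?thesis
  proof cases
    case 1
    then show ?thesis
      using assms t by (intro total_damping_ge[where u = "9 / 20"]) (auto simp: cut_def rate_def power2_eq_square)
  next
    case 2
    then show ?thesis
      using assms t by (intro total_damping_ge[where u = "11 / 20"]) (auto simp: cut_def rate_def power2_eq_square)
  next
    case 3
    then show ?thesis
      using assms t by (intro total_damping_ge[where u = "7 / 10"]) (auto simp: cut_def rate_def power2_eq_square)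
  next
    case 4
    then show ?thesis
      using assms t by (intro total_damping_ge[where u = "7 / 5"]) (auto simp: cut_def rate_def power2_eq_square)
  qed
qed

lemma tail_nonneg: "0 \<le> \<theta> \<Longrightarrow> 0 \<le> tail t j \<theta>"
  unfolding tail_def by (intro sum_nonneg) auto

lemma damping_le_tail:
  assumes "9 / 20 * t \<le> \<theta>" "\<theta> \<le> pi"
  shows "exp (- total_damping t \<theta>) * \<theta> ^ j \<le> tail t j \<theta>"
proof -
  have \<theta>: "0 \<le> \<theta>" using assms t by linarith
  have "\<exists>i<4. \<theta> \<in> {cut t i..cut t (Suc i)}"
  proof -
    consider "\<theta> \<le> 11 / 20 * t" | "11 / 20 * t \<le> \<theta>" "\<theta> \<le> 7 / 10 * t"
      | "7 / 10 * t \<le> \<theta>" "\<theta> \<le> 7 / 5 * t" | "7 / 5 * t \<le> \<theta>" by linarith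
    then show ?thesis
    proof cases
      case 1 then show ?thesis using assms by (intro exI[of _ 0]) (auto simp: cut_def)
    next
      case 2 then show ?thesis by (intro exI[of _ 1]) (auto simp: cut_def)
    next
      case 3 then show ?thesis by (intro exI[of _ 2]) (auto simp: cut_def numeral_eq_Suc)
    next
      case 4 then show ?thesis using assms by (intro exI[of _ 3]) (auto simp: cut_def numeral_eq_Suc)
    qed
  qed
  then obtain i where i: "i < 4" "\<theta> \<in> {cut t i..cut t (Suc i)}" by blast
  have "exp (- total_damping t \<theta>) * \<theta> ^ j \<le> exp (- (rate i / t)) * (if \<theta> \<in> {cut t i..cut t (Suc i)} then \<theta> ^ j else 0)"
    using i \<theta> rate_le_damping[OF i(1), of \<theta>] assms by (auto intro!: mult_right_mono)
  also have "\<dots> \<le> tail t j \<theta>"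
    unfolding tail_def using i(1) \<theta> by (intro member_le_sum) auto
  finally show ?thesis .
qed

lemma tail_has_integral:
  "(tail t j has_integral (\<Sum>i<4. exp (- (rate i / t)) * ((cut t (Suc i) ^ Suc j - cut t i ^ Suc j) / real (Suc j)))) {0..pi}"
  unfolding tail_def
  by (intro has_integral_sum has_integral_mult_right has_integral_power_piece cut_bounds) auto

lemma damping_le_gaussian_tail:
  assumes "0 \<le> \<theta>" "\<theta> \<le> pi"
  shows "exp (- total_damping t \<theta>) * \<theta> ^ j \<le> exp (- (6 / 5 / t ^ 3 * \<theta>\<^sup>2)) * \<theta> ^ j + tail t j \<theta>"
proof (cases "\<theta> \<le> 9 / 20 * t")
  case True
  then have "exp (- total_damping t \<theta>) * \<theta> ^ j \<le> exp (- (6 / 5 / t ^ 3 * \<theta>\<^sup>2)) * \<theta> ^ j"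
    using total_damping_ge_quadratic[OF t assms(1)] assms by (intro mult_right_mono) auto
  then show ?thesis using tail_nonneg[OF assms(1), of j] by linarith
next
  case False
  then have "exp (- total_damping t \<theta>) * \<theta> ^ j \<le> tail t j \<theta>"
    using assms by (intro damping_le_tail) auto
  moreover have "0 \<le> exp (- (6 / 5 / t ^ 3 * \<theta>\<^sup>2)) * \<theta> ^ j" using assms by simp
  ultimately show ?thesis by linarith
qed

text \<open>On the peak the phase contributes \<theta>^3 and sin \<theta> one more factor, hence a
  fourth moment; on the tail the sine of the phase is bounded by 1.\<close>

lemma sine_part_le:
  assumes "0 \<le> \<theta>" "\<theta> \<le> pi"
  shows "\<bar>exp (- total_damping t \<theta>) * sin (total_phase t \<theta>) * sin \<theta>\<bar>
    \<le> 181 / 100 / t ^ 4 * (exp (- (6 / 5 / t ^ 3 * \<theta>\<^sup>2)) * \<theta> ^ 4) + tail t 1 \<theta>"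
proof (cases "\<theta> \<le> 9 / 20 * t")
  case True
  have "\<bar>exp (- total_damping t \<theta>) * sin (total_phase t \<theta>) * sin \<theta>\<bar>
      = exp (- total_damping t \<theta>) * \<bar>sin (total_phase t \<theta>)\<bar> * \<bar>sin \<theta>\<bar>"
    by (simp add: abs_mult)
  also have "\<dots> \<le> exp (- (6 / 5 / t ^ 3 * \<theta>\<^sup>2)) * (181 / 100 * \<bar>\<theta>\<bar> ^ 3 / t ^ 4) * \<bar>\<theta>\<bar>"
    using total_damping_ge_quadratic[OF t assms(1) True] t
      order_trans[OF abs_sin_x_le_abs_x abs_total_phase_le[OF t(1), of \<theta>]] abs_sin_x_le_abs_x[of \<theta>]
    by (intro mult_mono) auto
  also have "\<dots> = 181 / 100 / t ^ 4 * (exp (- (6 / 5 / t ^ 3 * \<theta>\<^sup>2)) * \<theta> ^ 4)"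
    using assms by (simp add: power4_eq_xxxx power3_eq_cube)
  finally show ?thesis using tail_nonneg[OF assms(1), of 1] by linarith
next
  case False
  have "\<bar>exp (- total_damping t \<theta>) * sin (total_phase t \<theta>) * sin \<theta>\<bar>
      = exp (- total_damping t \<theta>) * \<bar>sin (total_phase t \<theta>)\<bar> * \<bar>sin \<theta>\<bar>"
    by (simp add: abs_mult)
  also have "\<dots> \<le> exp (- total_damping t \<theta>) * 1 * \<theta>"
    using abs_sin_x_le_abs_x[of \<theta>] assms by (intro mult_mono) auto
  also have "\<dots> \<le> tail t 1 \<theta>" using damping_le_tail[of \<theta> 1] False assms by simp
  finally show ?thesis using t assms by (smt (verit) divide_nonneg_nonneg mult_nonneg_nonneg exp_ge_zero zero_le_power)
qed

text \<open>On the peak cos x >= 1 - x^2 / 2 costs half the squared phase bound, and 32761/20000 is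
  1.81^2 / 2. On the tail the step function counts twice: once because the cosine may be -1 and once
  to cancel the Gaussian of the main term.\<close>

lemma cosine_part_ge:
  assumes "0 \<le> \<theta>" "\<theta> \<le> pi"
  shows "exp (- (329 / 200 / t ^ 3 * \<theta>\<^sup>2))
      - 32761 / 20000 / t ^ 8 * (exp (- (6 / 5 / t ^ 3 * \<theta>\<^sup>2)) * \<theta> ^ 6) - 2 * tail t 0 \<theta>
    \<le> exp (- total_damping t \<theta>) * cos (total_phase t \<theta>)"
proof -
  define D where "D = exp (- total_damping t \<theta>)"
  have D: "exp (- (329 / 200 / t ^ 3 * \<theta>\<^sup>2)) \<le> D"
    using total_damping_le[OF t(1), of \<theta>] by (simp add: D_def)
  show ?thesis
  proof (cases "\<theta> \<le> 9 / 20 * t")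
    case True
    have "(total_phase t \<theta>)\<^sup>2 \<le> (181 / 100 * \<bar>\<theta>\<bar> ^ 3 / t ^ 4)\<^sup>2"
      using abs_total_phase_le[OF t(1), of \<theta>] by (rule abs_le_square_iff[THEN iffD1, OF order_trans]) auto
    then have "D * ((total_phase t \<theta>)\<^sup>2 / 2) \<le> exp (- (6 / 5 / t ^ 3 * \<theta>\<^sup>2)) * ((181 / 100 * \<bar>\<theta>\<bar> ^ 3 / t ^ 4)\<^sup>2 / 2)"
      using total_damping_ge_quadratic[OF t assms(1) True] unfolding D_def by (intro mult_mono) auto
    also have "\<dots> = 32761 / 20000 / t ^ 8 * (exp (- (6 / 5 / t ^ 3 * \<theta>\<^sup>2)) * \<theta> ^ 6)"
      using assms by (simp add: power_divide power_mult_distrib flip: power_mult)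
    finally have "D * ((total_phase t \<theta>)\<^sup>2 / 2) \<le> \<dots>" .
    moreover have "D * (1 - (total_phase t \<theta>)\<^sup>2 / 2) \<le> D * cos (total_phase t \<theta>)"
      using one_minus_cos_le[of "total_phase t \<theta>"] by (intro mult_left_mono) (auto simp: D_def)
    ultimately show ?thesis
      using D tail_nonneg[OF assms(1), of 0] unfolding D_def[symmetric] by (simp add: algebra_simps)
  next
    case False
    then have "D \<le> tail t 0 \<theta>" using damping_le_tail[of \<theta> 0] assms by (simp add: D_def)
    moreover have "D * (- 1) \<le> D * cos (total_phase t \<theta>)"
      by (intro mult_left_mono) (auto simp: D_def)
    moreover have "0 \<le> 32761 / 20000 / t ^ 8 * (exp (- (6 / 5 / t ^ 3 * \<theta>\<^sup>2)) * \<theta> ^ 6)"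
      using assms t by simp
    ultimately show ?thesis using D unfolding D_def[symmetric] by linarith
  qed
qed

end

section \<open>Numerical bounds in powers of q = sqrt t\<close>

lemma exp_neg_le_inverse_power:
  fixes x y c :: real
  assumes "0 \<le> y" "real n * y \<le> x" "c \<le> (1 + y + y\<^sup>2 / 2 + y ^ 3 / 6) ^ n" "0 < c"
  shows "exp (- x) \<le> 1 / c"
proof -
  have "c \<le> (1 + y + y\<^sup>2 / 2 + y ^ 3 / 6) ^ n" by fact
  also have "\<dots> \<le> exp y ^ n" using assms exp_ge_cubic[of y] by (intro power_mono) auto
  also have "\<dots> = exp (real n * y)" by (simp add: exp_of_nat_mult)
  also have "\<dots> \<le> exp x" using assms by simp
  finally show ?thesis using assms by (simp add: exp_minus field_simps)
qed

text \<open>The power q^3 matches the width of the peak. The last rate gets q^9 since its interval,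
  ending at \<pi>, does not shrink with q.\<close>

lemma exp_rate_le:
  assumes q: "0 < q" "q\<^sup>2 \<le> 1 / 22"
  shows "exp (- (rate 0 / q\<^sup>2)) \<le> 504 / 1000 * q ^ 3"
    and "exp (- (rate 1 / q\<^sup>2)) \<le> 68 / 1000 * q ^ 3"
    and "exp (- (rate 2 / q\<^sup>2)) \<le> 34 / 10000 * q ^ 3"
    and "exp (- (rate 3 / q\<^sup>2)) \<le> 71 / 100000 * q ^ 9"
proof -
  have q1: "q \<le> 2133 / 10000"
    by (rule power2_le_imp_le) (use q in \<open>auto simp: power2_eq_square\<close>)
  \<comment> \<open>Powers of t give even powers of q only; bounding a single factor q by 0.2133
    yields an odd one.\<close>
  have p4: "(q\<^sup>2 / (1 / 22)) ^ 2 \<le> 10324 / 100 * q ^ 3"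
  proof -
    have "(q\<^sup>2 / (1 / 22)) ^ 2 = 484 * (q * q ^ 3)"
      by (simp add: power2_eq_square power3_eq_cube)
    also have "\<dots> \<le> 484 * (2133 / 10000 * q ^ 3)"
      using q1 q(1) by (intro mult_left_mono mult_right_mono) auto
    also have "\<dots> \<le> 10324 / 100 * q ^ 3" using q(1) by simp
    finally show ?thesis .
  qed
  have p10: "(q\<^sup>2 / (1 / 22)) ^ 5 \<le> 1099300 * q ^ 9"
  proof -
    have "(q\<^sup>2 / (1 / 22)) ^ 5 = 5153632 * (q * q ^ 9)"
      by (simp add: power_mult_distrib flip: power_mult power_Suc)
    also have "\<dots> \<le> 5153632 * (2133 / 10000 * q ^ 9)"
      using q1 q(1) by (intro mult_left_mono mult_right_mono) auto
    also have "\<dots> \<le> 1099300 * q ^ 9" using q(1) by simp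
    finally show ?thesis .
  qed
  have *: "exp (- (E / q\<^sup>2)) \<le> 1 / c * (B * q ^ j)"
    if "real k / 22 \<le> E" "exp (- (22 * E)) \<le> 1 / c" "(q\<^sup>2 / (1 / 22)) ^ k \<le> B * q ^ j" "0 < c"
    for E c B :: real and k j
  proof -
    have "exp (- (E / q\<^sup>2)) \<le> exp (- (E / (1 / 22))) * (q\<^sup>2 / (1 / 22)) ^ k"
      using that q by (intro exp_neg_le_power) auto
    also have "\<dots> \<le> 1 / c * (B * q ^ j)"
      using that by (intro mult_mono) (auto simp: mult.commute)
    finally show ?thesis .
  qed
  \<comment> \<open>The constant at t = 1/22 is certified by rational arithmetic: 16 * 1/3 lies just
    below 22 * 243/1000, and \<open>y\<close> and \<open>n\<close> are chosen likewise for the other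
    rates.\<close>
  have "exp (- (rate 0 / q\<^sup>2)) \<le> 1 / 205 * (10324 / 100 * q ^ 3)"
    by (rule *[OF _ exp_neg_le_inverse_power[where y = "1 / 3" and n = 16] p4])
       (auto simp: rate_def power_divide)
  also have "\<dots> \<le> 504 / 1000 * q ^ 3" using q(1) by simp
  finally show "exp (- (rate 0 / q\<^sup>2)) \<le> 504 / 1000 * q ^ 3" .
  have "exp (- (rate 1 / q\<^sup>2)) \<le> 1 / 1530 * (10324 / 100 * q ^ 3)"
    by (rule *[OF _ exp_neg_le_inverse_power[where y = "46 / 100" and n = 16] p4])
       (auto simp: rate_def power_divide)
  also have "\<dots> \<le> 68 / 1000 * q ^ 3" using q(1) by simp
  finally show "exp (- (rate 1 / q\<^sup>2)) \<le> 68 / 1000 * q ^ 3" .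
  have "exp (- (rate 2 / q\<^sup>2)) \<le> 1 / 30500 * (10324 / 100 * q ^ 3)"
    by (rule *[OF _ exp_neg_le_inverse_power[where y = "65 / 100" and n = 16] p4])
       (auto simp: rate_def power_divide)
  also have "\<dots> \<le> 34 / 10000 * q ^ 3" using q(1) by simp
  finally show "exp (- (rate 2 / q\<^sup>2)) \<le> 34 / 10000 * q ^ 3" .
  have "exp (- (rate 3 / q\<^sup>2)) \<le> 1 / 1570000000 * (1099300 * q ^ 9)"
    by (rule *[OF _ exp_neg_le_inverse_power[where y = "2 / 3" and n = 32] p10])
       (auto simp: rate_def power_divide)
  also have "\<dots> \<le> 71 / 100000 * q ^ 9" using q(1) by simp
  finally show "exp (- (rate 3 / q\<^sup>2)) \<le> 71 / 100000 * q ^ 9" .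
qed

text \<open>The pieces with ends proportional to t = q^2 give q^3 q^(2 j + 2); the last piece,
  already of order q^9, fits in every case.\<close>

lemma tail_integral_le:
  assumes q: "0 < q" "q\<^sup>2 \<le> 1 / 22"
  shows "integral {0..pi} (tail (q\<^sup>2) 0) \<le> 64 / 1000 * q ^ 5"
    and "integral {0..pi} (tail (q\<^sup>2) 1) \<le> 35 / 1000 * q ^ 7"
    and "integral {0..pi} (tail (q\<^sup>2) 2) \<le> 268 / 10000 * q ^ 9"
proof -
  have t: "0 < q\<^sup>2" using q(1) by simp
  define e where "e i = exp (- (rate i / q\<^sup>2))" for i
  have e: "e 0 \<le> 504 / 1000 * q ^ 3" "e 1 \<le> 68 / 1000 * q ^ 3"
    "e 2 \<le> 34 / 10000 * q ^ 3" "e 3 \<le> 71 / 100000 * q ^ 9" "0 \<le> e i" for i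
    using exp_rate_le[OF q] by (simp_all add: e_def)
  have int: "integral {0..pi} (tail (q\<^sup>2) j) =
      e 0 * (((11 / 20 * q\<^sup>2) ^ Suc j - (9 / 20 * q\<^sup>2) ^ Suc j) / real (Suc j))
    + e 1 * (((7 / 10 * q\<^sup>2) ^ Suc j - (11 / 20 * q\<^sup>2) ^ Suc j) / real (Suc j))
    + e 2 * (((7 / 5 * q\<^sup>2) ^ Suc j - (7 / 10 * q\<^sup>2) ^ Suc j) / real (Suc j))
    + e 3 * ((pi ^ Suc j - (7 / 5 * q\<^sup>2) ^ Suc j) / real (Suc j))" for j
    unfolding integral_unique[OF tail_has_integral[OF t q(2)]] e_def
    by (simp add: lessThan_nat_numeral cut_def del: power_Suc of_nat_Suc)
  have last: "e 3 * ((pi ^ Suc j - (7 / 5 * q\<^sup>2) ^ Suc j) / real (Suc j)) \<le> 71 / 100000 * q ^ 9 * (c / real (Suc j))"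
    if "pi ^ Suc j \<le> c" for j c
  proof -
    have "0 \<le> (7 / 5 * q\<^sup>2) ^ Suc j" by (intro zero_le_power) simp
    then have "pi ^ Suc j - (7 / 5 * q\<^sup>2) ^ Suc j \<le> c" using that by linarith
    then have "(pi ^ Suc j - (7 / 5 * q\<^sup>2) ^ Suc j) / real (Suc j) \<le> c / real (Suc j)"
      by (rule divide_right_mono) simp
    moreover have "0 \<le> c" using that zero_le_power[OF pi_ge_zero, of "Suc j"] by linarith
    ultimately show ?thesis
      using e(4) e(5)[of 3] by (meson mult_left_mono mult_right_mono order_trans divide_nonneg_nonneg of_nat_0_le_iff)
  qed
  have "pi ^ Suc 0 \<le> 32 / 10" "pi ^ Suc 1 \<le> (32 / 10) ^ Suc 1" "pi ^ Suc 2 \<le> (315 / 100) ^ Suc 2"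
    using pi_approx by (auto intro!: power_mono simp del: power_Suc)
  note L = last[OF this(1)] last[OF this(2)] last[OF this(3)]
  have mid: "e i * (w * q ^ k) \<le> d * q ^ 3 * (w * q ^ k)" if "e i \<le> d * q ^ 3" "0 \<le> w" for i w d k
    using that q(1) by (intro mult_right_mono) auto
  have q2: "q ^ 9 \<le> q ^ 5 / 484" "q ^ 9 \<le> q ^ 7 / 22"
  proof -
    have "q ^ 9 = q ^ 7 * q\<^sup>2" by (simp flip: power_add)
    also have "\<dots> \<le> q ^ 7 * (1 / 22)" using q by (intro mult_left_mono) auto
    finally show 1: "q ^ 9 \<le> q ^ 7 / 22" by simp
    have "q ^ 7 = q ^ 5 * q\<^sup>2" by (simp flip: power_add)
    also have "\<dots> \<le> q ^ 5 * (1 / 22)" using q by (intro mult_left_mono) auto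
    finally show "q ^ 9 \<le> q ^ 5 / 484" using 1 by simp
  qed
  have "integral {0..pi} (tail (q\<^sup>2) 0) = e 0 * (1 / 10 * q ^ 2) + e 1 * (3 / 20 * q ^ 2) + e 2 * (7 / 10 * q ^ 2)
      + e 3 * ((pi ^ Suc 0 - (7 / 5 * q\<^sup>2) ^ Suc 0) / real (Suc 0))"
    unfolding int by (simp add: algebra_simps)
  also have "\<dots> \<le> 504 / 1000 * q ^ 3 * (1 / 10 * q ^ 2) + 68 / 1000 * q ^ 3 * (3 / 20 * q ^ 2)
      + 34 / 10000 * q ^ 3 * (7 / 10 * q ^ 2) + 71 / 100000 * q ^ 9 * (32 / 10 / real (Suc 0))"
    by (intro add_mono mid e L) auto
  also have "\<dots> = 6298 / 100000 * q ^ 5 + 2272 / 1000000 * q ^ 9"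
    by (simp add: eval_nat_numeral)
  also have "\<dots> \<le> 64 / 1000 * q ^ 5" using q2 zero_le_power[OF less_imp_le[OF q(1)], of 5] by linarith
  finally show "integral {0..pi} (tail (q\<^sup>2) 0) \<le> 64 / 1000 * q ^ 5" .
  have "integral {0..pi} (tail (q\<^sup>2) 1) = e 0 * (1 / 20 * q ^ 4) + e 1 * (3 / 32 * q ^ 4) + e 2 * (147 / 200 * q ^ 4)
      + e 3 * ((pi ^ Suc 1 - (7 / 5 * q\<^sup>2) ^ Suc 1) / real (Suc 1))"
    unfolding int by (simp add: power_mult_distrib power_divide eval_nat_numeral)
  also have "\<dots> \<le> 504 / 1000 * q ^ 3 * (1 / 20 * q ^ 4) + 68 / 1000 * q ^ 3 * (3 / 32 * q ^ 4)
      + 34 / 10000 * q ^ 3 * (147 / 200 * q ^ 4) + 71 / 100000 * q ^ 9 * ((32 / 10) ^ Suc 1 / real (Suc 1))"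
    by (intro add_mono mid e L) auto
  also have "\<dots> = 34074 / 1000000 * q ^ 7 + 36352 / 10000000 * q ^ 9"
    by (simp add: eval_nat_numeral)
  also have "\<dots> \<le> 35 / 1000 * q ^ 7" using q2 zero_le_power[OF less_imp_le[OF q(1)], of 7] by linarith
  finally show "integral {0..pi} (tail (q\<^sup>2) 1) \<le> 35 / 1000 * q ^ 7" .
  have "integral {0..pi} (tail (q\<^sup>2) 2) = e 0 * (301 / 12000 * q ^ 6) + e 1 * (471 / 8000 * q ^ 6) + e 2 * (2401 / 3000 * q ^ 6)
      + e 3 * ((pi ^ Suc 2 - (7 / 5 * q\<^sup>2) ^ Suc 2) / real (Suc 2))"
    unfolding int by (simp add: power_mult_distrib power_divide eval_nat_numeral)
  also have "\<dots> \<le> 504 / 1000 * q ^ 3 * (301 / 12000 * q ^ 6) + 68 / 1000 * q ^ 3 * (471 / 8000 * q ^ 6)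
      + 34 / 10000 * q ^ 3 * (2401 / 3000 * q ^ 6) + 71 / 100000 * q ^ 9 * ((315 / 100) ^ Suc 2 / real (Suc 2))"
    by (intro add_mono mid e L) auto
  also have "\<dots> \<le> 268 / 10000 * q ^ 9"
    using q(1) by (simp add: eval_nat_numeral)
  finally show "integral {0..pi} (tail (q\<^sup>2) 2) \<le> 268 / 10000 * q ^ 9" .
qed

lemma gaussian_integral_le:
  assumes q: "0 < q"
  defines "G \<equiv> \<lambda>k. integral {0..pi} (\<lambda>\<theta>. exp (- (6 / 5 / (q\<^sup>2) ^ 3 * \<theta>\<^sup>2)) * \<theta> ^ (2 * k))"
  shows "G 0 \<le> 8092 / 10000 * q ^ 3" "G 1 \<le> 3373 / 10000 * q ^ 9"
    "G 2 \<le> 4217 / 10000 * q ^ 15" "G 3 \<le> 8788 / 10000 * q ^ 21"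
proof -
  define \<alpha> where "\<alpha> = 6 / 5 / (q\<^sup>2) ^ 3"
  have \<alpha>: "0 < \<alpha>" using q by (simp add: \<alpha>_def)
  \<comment> \<open>0.913 lies just above sqrt (5/6).\<close>
  have s: "0 \<le> 1 / sqrt \<alpha>" "1 / sqrt \<alpha> \<le> 913 / 1000 * q ^ 3"
  proof -
    have "(1 / sqrt \<alpha>)\<^sup>2 = 1 / \<alpha>" using \<alpha> by (simp add: power_divide)
    also have "\<dots> = 5 / 6 * q ^ 6" using q by (simp add: \<alpha>_def flip: power_mult)
    also have "\<dots> \<le> (913 / 1000 * q ^ 3)\<^sup>2"
      using q by (simp add: power_mult_distrib power_divide flip: power_mult)
    finally show "1 / sqrt \<alpha> \<le> 913 / 1000 * q ^ 3"
      by (rule power2_le_imp_le) (use q in simp)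
    show "0 \<le> 1 / sqrt \<alpha>" using \<alpha> by simp
  qed
  have G: "G k \<le> 17725 / 20000 * (fact (2 * k) / (2 ^ (2 * k) * fact k)) * (913 / 1000 * q ^ 3) ^ (2 * k + 1)" for k
  proof -
    have "G k \<le> sqrt pi / 2 * (fact (2 * k) / (2 ^ (2 * k) * fact k)) * (1 / sqrt \<alpha>) ^ (2 * k + 1)"
      unfolding G_def \<alpha>_def[symmetric] by (rule half_gaussian_moment_upto(2)[OF \<alpha>])
    also have "\<dots> \<le> 17725 / 20000 * (fact (2 * k) / (2 ^ (2 * k) * fact k)) * (913 / 1000 * q ^ 3) ^ (2 * k + 1)"
      using sqrt_pi_bounds s q by (intro mult_mono power_mono) auto
    finally show ?thesis .
  qed
  have pw: "(913 / 1000 * q ^ 3) ^ n = (913 / 1000) ^ n * q ^ (3 * n)" for n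
    unfolding power_mult_distrib by (simp flip: power_mult)
  have "G 0 \<le> 17725 / 20000 * (913 / 1000 * q ^ 3)"
    using G[of 0] by simp
  also have "\<dots> \<le> 8092 / 10000 * q ^ 3" using q by simp
  finally show "G 0 \<le> 8092 / 10000 * q ^ 3" .
  have "G 1 \<le> 17725 / 20000 * (1 / 2) * ((913 / 1000) ^ 3 * q ^ 9)"
    using G[of 1] unfolding pw by (simp add: fact_numeral)
  also have "\<dots> \<le> 3373 / 10000 * q ^ 9" using q by (simp add: power_divide)
  finally show "G 1 \<le> 3373 / 10000 * q ^ 9" .
  have "G 2 \<le> 17725 / 20000 * (3 / 4) * ((913 / 1000) ^ 5 * q ^ 15)"
    using G[of 2] unfolding pw by (simp add: fact_numeral)
  also have "\<dots> \<le> 4217 / 10000 * q ^ 15" using q by (simp add: power_divide)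
  finally show "G 2 \<le> 4217 / 10000 * q ^ 15" .
  have "G 3 \<le> 17725 / 20000 * (15 / 8) * ((913 / 1000) ^ 7 * q ^ 21)"
    using G[of 3] unfolding pw by (simp add: fact_numeral)
  also have "\<dots> \<le> 8788 / 10000 * q ^ 21" using q by (simp add: power_divide)
  finally show "G 3 \<le> 8788 / 10000 * q ^ 21" .
qed

lemma gaussian_integral_ge:
  assumes q: "0 < q" "q\<^sup>2 \<le> 1 / 22"
  shows "6907 / 10000 * q ^ 3 \<le> integral {0..pi} (\<lambda>\<theta>. exp (- (329 / 200 / (q\<^sup>2) ^ 3 * \<theta>\<^sup>2)))"
proof -
  define \<alpha> where "\<alpha> = 329 / 200 / (q\<^sup>2) ^ 3"
  have \<alpha>: "0 < \<alpha>" using q by (simp add: \<alpha>_def)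
  have sq: "(1 / sqrt \<alpha>)\<^sup>2 = 200 / 329 * q ^ 6"
    using \<alpha> q by (simp add: power_divide \<alpha>_def flip: power_mult)
  \<comment> \<open>0.7796 lies just below sqrt (200/329).\<close>
  have "(7796 / 10000 * q ^ 3)\<^sup>2 \<le> (1 / sqrt \<alpha>)\<^sup>2"
    unfolding sq using q by (simp add: power_mult_distrib power_divide flip: power_mult)
  then have 1: "7796 / 10000 * q ^ 3 \<le> 1 / sqrt \<alpha>"
    by (rule power2_le_imp_le) (use \<alpha> in simp)
  have "(1 / sqrt \<alpha>)\<^sup>2 \<le> (q ^ 3)\<^sup>2"
    unfolding sq using q by (simp flip: power_mult)
  then have 2: "1 / sqrt \<alpha> \<le> q ^ 3"
    by (rule power2_le_imp_le) (use q in simp)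
  have "(1 / sqrt \<alpha>) ^ 3 \<le> (q ^ 3) ^ 3" using 2 \<alpha> by (intro power_mono) auto
  also have "\<dots> = q ^ 3 * (q\<^sup>2) ^ 3" by (simp flip: power_mult power_add)
  also have "\<dots> \<le> q ^ 3 * (1 / 22) ^ 3" using q by (intro mult_left_mono power_mono) auto
  also have "\<dots> \<le> q ^ 3 / 10000" using q by (simp add: power_divide)
  finally have 3: "(1 / sqrt \<alpha>) ^ 3 \<le> q ^ 3 / 10000" .
  have "17724 / 20000 * (7796 / 10000 * q ^ 3) \<le> sqrt pi / 2 * (1 / sqrt \<alpha>)"
    using 1 sqrt_pi_bounds q by (intro mult_mono) auto
  moreover have "0 < q ^ 3" using q by simp
  ultimately have "6907 / 10000 * q ^ 3 \<le> sqrt pi / 2 * (1 / sqrt \<alpha>) - (1 / sqrt \<alpha>) ^ 3"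
    using 3 by linarith
  also have "\<dots> \<le> integral {0..pi} (\<lambda>\<theta>. exp (- (\<alpha> * \<theta>\<^sup>2)))" by (rule half_gaussian_ge[OF \<alpha>])
  finally show ?thesis by (simp only: \<alpha>_def)
qed

section \<open>Log-concavity up to a factor 1 + O(t^3)\<close>

lemma saddle_integrals_log_concavity:
  fixes t :: real
  defines "D \<equiv> \<lambda>\<theta>. exp (- total_damping t \<theta>)" and "\<phi> \<equiv> total_phase t"
  assumes t: "0 < t" "t \<le> 1 / 22"
    and a: "((\<lambda>\<theta>. D \<theta> * cos (\<phi> \<theta>)) has_integral a) {0..pi}"
    and b: "((\<lambda>\<theta>. D \<theta> * cos (\<phi> \<theta> + \<theta>)) has_integral b) {0..pi}"
    and c: "((\<lambda>\<theta>. D \<theta> * cos (\<phi> \<theta> - \<theta>)) has_integral c) {0..pi}"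
    and pos: "0 < a" "0 < b" "0 < c"
  shows "a\<^sup>2 < (1 + 967 / 1000 * t ^ 3) * (b * c)"
proof -
  \<comment> \<open>Everything becomes an integer power of q: the bounds are of order q^3 for a and
    for a + C, q^9 for a - C and q^7 for S. Both sides are compared at order q^12.\<close>
  define q where "q = sqrt t"
  have q: "0 < q" "q\<^sup>2 = t" using t by (simp_all add: q_def)
  have q22: "q\<^sup>2 \<le> 1 / 22" using q t by simp
  define g where "g k \<theta> = exp (- (6 / 5 / t ^ 3 * \<theta>\<^sup>2)) * \<theta> ^ (2 * k)" for k :: nat and \<theta> :: real
  define G where "G k = integral {0..pi} (g k)" for k
  define T where "T j = integral {0..pi} (tail t j)" for j
  have gi: "(g k has_integral G k) {0..pi}" for k
    unfolding G_def g_def using t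
    by (intro integrable_integral half_gaussian_moment_upto) auto
  have Ti: "(tail t j has_integral T j) {0..pi}" for j
    unfolding T_def using tail_has_integral[OF t, of j] by (simp add: has_integral_integral[symmetric] has_integral_integrable)
  note G = gaussian_integral_le[OF q(1), unfolded q(2), folded g_def, folded G_def]
  note T = tail_integral_le[OF q(1) q22, unfolded q(2), folded T_def]
  define C S where "C = (b + c) / 2" and "S = (c - b) / 2"
  have Ci: "((\<lambda>\<theta>. D \<theta> * cos (\<phi> \<theta>) * cos \<theta>) has_integral C) {0..pi}"
    using has_integral_divide[OF has_integral_add[OF b c], of 2]
    by (simp add: C_def cos_add cos_diff algebra_simps)
  have Si: "((\<lambda>\<theta>. D \<theta> * sin (\<phi> \<theta>) * sin \<theta>) has_integral S) {0..pi}"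
    using has_integral_divide[OF has_integral_diff[OF c b], of 2]
    by (simp add: S_def cos_add cos_diff algebra_simps)
  have D: "0 \<le> D \<theta>" for \<theta> by (simp add: D_def)
  have AC: "a + C \<le> 2 * (G 0 + T 0)"
  proof (rule has_integral_le[OF has_integral_add[OF a Ci] has_integral_mult_right[OF has_integral_add[OF gi Ti]]])
    fix \<theta> :: real assume \<theta>: "\<theta> \<in> {0..pi}"
    have "D \<theta> * (cos (\<phi> \<theta>) * (1 + cos \<theta>)) \<le> D \<theta> * 2"
    proof (intro mult_left_mono D)
      have "cos (\<phi> \<theta>) * (1 + cos \<theta>) \<le> 1 * (1 + cos \<theta>)"
        using cos_ge_minus_one[of \<theta>] by (intro mult_right_mono cos_le_one) linarith
      also have "\<dots> \<le> 2" by simp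
      finally show "cos (\<phi> \<theta>) * (1 + cos \<theta>) \<le> 2" .
    qed
    moreover have "D \<theta> \<le> g 0 \<theta> + tail t 0 \<theta>"
      using damping_le_gaussian_tail[OF t, of \<theta> 0] \<theta> by (simp add: D_def g_def)
    ultimately show "D \<theta> * cos (\<phi> \<theta>) + D \<theta> * cos (\<phi> \<theta>) * cos \<theta> \<le> 2 * (g 0 \<theta> + tail t 0 \<theta>)"
      by (simp add: algebra_simps)
  qed
  have q5: "q ^ 5 \<le> q ^ 3 / 22"
  proof -
    have "q ^ 5 = q ^ 3 * q\<^sup>2" by (simp flip: power_add)
    also have "\<dots> \<le> q ^ 3 * (1 / 22)" using q22 q(1) by (intro mult_left_mono) auto
    finally show ?thesis by simp
  qed
  have q3: "0 < q ^ 3" using q(1) by simp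
  have "2 * (G 0 + T 0) \<le> 2 * (8092 / 10000 * q ^ 3 + 64 / 1000 * (q ^ 3 / 22))"
    using G(1) T(1) q5 by (intro mult_left_mono add_mono) auto
  also have "\<dots> \<le> 16244 / 10000 * q ^ 3" using q3 by simp
  finally have A: "a + C \<le> 16244 / 10000 * q ^ 3"
    using AC by (rule order_trans[rotated])
  have BC: "a - C \<le> 1 / 2 * (G 1 + T 2)"
  proof (rule has_integral_le[OF has_integral_diff[OF a Ci] has_integral_mult_right[OF has_integral_add[OF gi Ti]]])
    fix \<theta> :: real assume \<theta>: "\<theta> \<in> {0..pi}"
    have "D \<theta> * (cos (\<phi> \<theta>) * (1 - cos \<theta>)) \<le> D \<theta> * (1 / 2 * \<theta>\<^sup>2)"
    proof (intro mult_left_mono D)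
      have "cos (\<phi> \<theta>) * (1 - cos \<theta>) \<le> 1 * (1 - cos \<theta>)"
        by (intro mult_right_mono) auto
      also have "\<dots> \<le> 1 / 2 * \<theta>\<^sup>2" using one_minus_cos_le[of \<theta>] by simp
      finally show "cos (\<phi> \<theta>) * (1 - cos \<theta>) \<le> 1 / 2 * \<theta>\<^sup>2" .
    qed
    moreover have "D \<theta> * \<theta>\<^sup>2 \<le> g 1 \<theta> + tail t 2 \<theta>"
      using damping_le_gaussian_tail[OF t, of \<theta> 2] \<theta> by (simp add: D_def g_def)
    ultimately show "D \<theta> * cos (\<phi> \<theta>) - D \<theta> * cos (\<phi> \<theta>) * cos \<theta> \<le> 1 / 2 * (g 1 \<theta> + tail t 2 \<theta>)"
      by (simp add: algebra_simps)
  qed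
  have "1 / 2 * (G 1 + T 2) \<le> 1 / 2 * (3373 / 10000 * q ^ 9 + 268 / 10000 * q ^ 9)"
    using G(2) T(3) by (intro mult_left_mono add_mono) auto
  also have "\<dots> = 18205 / 100000 * q ^ 9" by simp
  finally have B: "a - C \<le> 18205 / 100000 * q ^ 9"
    using BC by (rule order_trans[rotated])
  have Q: "\<bar>S\<bar> \<le> 181 / 100 / t ^ 4 * G 2 + T 1"
  proof -
    have Qi: "((\<lambda>\<theta>. 181 / 100 / t ^ 4 * g 2 \<theta> + tail t 1 \<theta>) has_integral (181 / 100 / t ^ 4 * G 2 + T 1)) {0..pi}"
      by (intro has_integral_add has_integral_mult_right gi Ti)
    have pt: "\<bar>D \<theta> * sin (\<phi> \<theta>) * sin \<theta>\<bar> \<le> 181 / 100 / t ^ 4 * g 2 \<theta> + tail t 1 \<theta>"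
      if "\<theta> \<in> {0..pi}" for \<theta>
      using sine_part_le[OF t, of \<theta>] that by (simp add: D_def \<phi>_def g_def)
    have "S \<le> 181 / 100 / t ^ 4 * G 2 + T 1"
      by (rule has_integral_le[OF Si Qi]) (use pt in fastforce)
    moreover have "- S \<le> 181 / 100 / t ^ 4 * G 2 + T 1"
      by (rule has_integral_le[OF has_integral_neg[OF Si] Qi]) (use pt in fastforce)
    ultimately show "\<bar>S\<bar> \<le> 181 / 100 / t ^ 4 * G 2 + T 1" by linarith
  qed
  have "181 / 100 / t ^ 4 * G 2 \<le> 181 / 100 / t ^ 4 * (4217 / 10000 * q ^ 15)"
    using G(3) t by (intro mult_left_mono) auto
  also have "\<dots> = 763277 / 1000000 * q ^ 7"
  proof -
    have "q ^ 15 = q ^ 7 * t ^ 4" unfolding q(2)[symmetric] by (simp flip: power_mult power_add)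
    then show ?thesis using t by simp
  qed
  finally have S7: "\<bar>S\<bar> \<le> 7983 / 10000 * q ^ 7"
    using Q T(2) zero_le_power[OF less_imp_le[OF q(1)], of 7] by linarith
  have "S\<^sup>2 \<le> (7983 / 10000 * q ^ 7)\<^sup>2"
    using power_mono[OF S7, of 2] by simp
  also have "\<dots> = (7983 / 10000)\<^sup>2 * (q ^ 12 * q\<^sup>2)"
    unfolding power_mult_distrib by (simp flip: power_mult power_add)
  \<comment> \<open>S^2 is of order q^14; the surplus q^2 is spent to reach order q^12.\<close>
  also have "\<dots> \<le> (7983 / 10000)\<^sup>2 * (q ^ 12 * (1 / 22))"
    using q22 q(1) by (intro mult_left_mono) auto
  also have "\<dots> \<le> 29 / 1000 * q ^ 12" using q(1) by (simp add: power_divide)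
  finally have S2: "S\<^sup>2 \<le> 29 / 1000 * q ^ 12" .
  have a1: "integral {0..pi} (\<lambda>\<theta>. exp (- (329 / 200 / t ^ 3 * \<theta>\<^sup>2))) - 32761 / 20000 / t ^ 8 * G 3 - 2 * T 0 \<le> a"
  proof (rule has_integral_le[OF _ a])
    show "((\<lambda>\<theta>. exp (- (329 / 200 / t ^ 3 * \<theta>\<^sup>2)) - 32761 / 20000 / t ^ 8 * g 3 \<theta> - 2 * tail t 0 \<theta>)
        has_integral (integral {0..pi} (\<lambda>\<theta>. exp (- (329 / 200 / t ^ 3 * \<theta>\<^sup>2))) - 32761 / 20000 / t ^ 8 * G 3 - 2 * T 0)) {0..pi}"
      by (intro has_integral_diff has_integral_mult_right gi Ti integrable_integral
            integrable_continuous_real continuous_intros)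
    show "exp (- (329 / 200 / t ^ 3 * \<theta>\<^sup>2)) - 32761 / 20000 / t ^ 8 * g 3 \<theta> - 2 * tail t 0 \<theta>
        \<le> D \<theta> * cos (\<phi> \<theta>)" if "\<theta> \<in> {0..pi}" for \<theta>
      using cosine_part_ge[OF t, of \<theta>] that by (simp add: D_def \<phi>_def g_def)
  qed
  have "32761 / 20000 / t ^ 8 * G 3 \<le> 32761 / 20000 / t ^ 8 * (8788 / 10000 * q ^ 21)"
    using G(4) t by (intro mult_left_mono) auto
  also have "\<dots> \<le> 144 / 100 * q ^ 5"
  proof -
    have "q ^ 21 = q ^ 5 * t ^ 8" unfolding q(2)[symmetric] by (simp flip: power_mult power_add)
    then show ?thesis using t q(1) by simp
  qed
  finally have a2: "32761 / 20000 / t ^ 8 * G 3 \<le> 144 / 100 * q ^ 5" .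
  \<comment> \<open>0.6907 - (1.44 + 2 * 0.064) / 22 is slightly more than 0.619.\<close>
  have a: "619 / 1000 * q ^ 3 \<le> a"
    using a1 a2 T(1) gaussian_integral_ge[OF q(1) q22, unfolded q(2)] q5 q3
    by linarith
  have "a\<^sup>2 - b * c = (a - C) * (a + C) + S\<^sup>2"
    by (simp add: C_def S_def power2_eq_square field_simps)
  also have "(a - C) * (a + C) \<le> (18205 / 100000 * q ^ 9) * (16244 / 10000 * q ^ 3)"
  proof -
    have "(a - C) * (a + C) \<le> (18205 / 100000 * q ^ 9) * (a + C)"
      using B pos by (intro mult_right_mono) (auto simp: C_def)
    also have "\<dots> \<le> (18205 / 100000 * q ^ 9) * (16244 / 10000 * q ^ 3)"
      using A q(1) by (intro mult_left_mono) auto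
    finally show ?thesis .
  qed
  also have "(18205 / 100000 * q ^ 9) * (16244 / 10000 * q ^ 3) = 29572202 / 100000000 * q ^ 12"
    by (simp flip: power_add)
  finally have d: "a\<^sup>2 - b * c \<le> 325 / 1000 * q ^ 12"
    using S2 zero_le_power[OF less_imp_le[OF q(1)], of 12] by linarith
  define x where "x = 967 / 1000 * t ^ 3"
  have "t ^ 3 \<le> (1 / 22) ^ 3" using t by (intro power_mono) auto
  then have x: "0 < x" "x \<le> 1 / 1000" using t by (simp_all add: x_def power_divide)
  have "(619 / 1000 * q ^ 3)\<^sup>2 \<le> a\<^sup>2" using a q(1) by (intro power_mono) auto
  then have xa: "x * (619 / 1000 * q ^ 3)\<^sup>2 \<le> x * a\<^sup>2" using x by (intro mult_left_mono) auto
  \<comment> \<open>The claim is equivalent to (1 + x) (a^2 - b c) < x a^2. In units of q^12 this is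
    0.3254 against 0.967 * 0.619^2, about 0.3705.\<close>
  have "(1 + x) * (a\<^sup>2 - b * c) \<le> (1 + x) * (325 / 1000 * q ^ 12)"
    using d x by (intro mult_left_mono) auto
  also have "\<dots> \<le> (1 + 1 / 1000) * (325 / 1000 * q ^ 12)"
    using x q(1) by (intro mult_right_mono) auto
  also have "\<dots> < 967 / 1000 * (619 / 1000)\<^sup>2 * q ^ 12"
    using q(1) by (simp add: power_divide)
  also have "\<dots> = x * (619 / 1000 * q ^ 3)\<^sup>2"
    unfolding x_def q(2)[symmetric] power_mult_distrib by (simp flip: power_mult power_add)
  also note xa
  finally have "(1 + x) * (a\<^sup>2 - b * c) < x * a\<^sup>2" .
  then have "a\<^sup>2 < (1 + x) * (b * c)" by (simp add: algebra_simps)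
  then show ?thesis by (simp only: x_def)
qed

section \<open>The ratio inequality\<close>

lemma partition_count_pos: "0 < partition_count n"
proof -
  have "sum_mset (replicate_mset n (1::nat)) = n" by (induction n) auto
  then have "replicate_mset n 1 \<in> bounded_partitions n n"
    by (cases n) (auto simp: bounded_partitions_def)
  then have "0 < card (bounded_partitions n n)"
    using finite_bounded_partitions card_gt_0_iff by blast
  then show ?thesis by (simp add: partition_count_def bounded_partitions_eq_all)
qed

lemma ratio_inequalityI:
  assumes "real (partition_count n) ^ 2 < real (partition_count (n - 1)) * real (partition_count (n + 1)) * (1 + y)"
    and "y * (24 * real n) powr (3 / 2) \<le> 240" and n: "0 < n"
  shows "real (partition_count (n - 1)) / real (partition_count n) * (1 + 240 / (24 * real n) powr (3 / 2))
    > real (partition_count n) / real (partition_count (n + 1))"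
proof -
  define a b c where "a = real (partition_count (n - 1))" and "b = real (partition_count n)"
    and "c = real (partition_count (n + 1))"
  have pos: "0 < a" "0 < b" "0 < c" using partition_count_pos by (simp_all add: a_def b_def c_def)
  define Y where "Y = 240 / (24 * real n) powr (3 / 2)"
  have "y \<le> Y" using assms(2) n by (simp add: Y_def pos_le_divide_eq)
  then have "a * c * (1 + y) \<le> a * c * (1 + Y)" using pos by (intro mult_left_mono) auto
  then have "b * b < a * c * (1 + Y)"
    using assms(1) by (simp add: a_def b_def c_def power2_eq_square)
  then have "b / c < a / b * (1 + Y)"
    using pos by (simp add: field_simps)
  then show ?thesis by (simp add: a_def b_def c_def Y_def)
qed

lemma powr_three_halves_square: "0 \<le> x \<Longrightarrow> (x powr (3 / 2))\<^sup>2 = x ^ 3" for x :: real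
proof -
  assume "0 \<le> x"
  have "(x powr (3 / 2))\<^sup>2 = x powr (3 / 2 + 3 / 2)"
    unfolding power2_eq_square by (rule powr_add[symmetric])
  also have "\<dots> = x ^ 3"
    using \<open>0 \<le> x\<close> by (simp add: powr_numeral)
  finally show ?thesis .
qed

lemma ratio_inequality_small:
  assumes "7 \<le> n" "n < 800"
  shows "real (partition_count (n - 1)) / real (partition_count n) * (1 + 240 / (24 * real n) powr (3 / 2))
    > real (partition_count n) / real (partition_count (n + 1))"
proof -
  obtain w :: int where w: "0 < w" "24 * int n ^ 3 \<le> w * w"
    "int (partition_count n) * int (partition_count n) * w
       < int (partition_count (n - 1)) * int (partition_count (n + 1)) * (w + 10)"
    using small_ratio_bound[OF assms] by blast
  define W where "W = real_of_int w"
  have W: "0 < W" using w(1) by (simp add: W_def)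
  have "real_of_int (24 * int n ^ 3) \<le> real_of_int (w * w)"
    using w(2) by (simp only: of_int_le_iff)
  then have W2: "24 * real n ^ 3 \<le> W\<^sup>2" by (simp add: W_def power2_eq_square)
  have "real_of_int (int (partition_count n) * int (partition_count n) * w)
      < real_of_int (int (partition_count (n - 1)) * int (partition_count (n + 1)) * (w + 10))"
    using w(3) by (simp only: of_int_less_iff)
  then have "real (partition_count n) ^ 2 * W
      < real (partition_count (n - 1)) * real (partition_count (n + 1)) * (W + 10)"
    by (simp add: W_def power2_eq_square)
  also have "\<dots> = real (partition_count (n - 1)) * real (partition_count (n + 1)) * (1 + 10 / W) * W"
    using W by (simp add: field_simps)
  finally have "real (partition_count n) ^ 2
      < real (partition_count (n - 1)) * real (partition_count (n + 1)) * (1 + 10 / W)"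
    using W by (simp only: mult_less_cancel_right_pos)
  moreover have "10 / W * (24 * real n) powr (3 / 2) \<le> 240"
  proof -
    have "((24 * real n) powr (3 / 2))\<^sup>2 = 576 * (24 * real n ^ 3)"
      by (simp add: powr_three_halves_square power_mult_distrib)
    also have "\<dots> \<le> (24 * W)\<^sup>2" using W2 by (simp add: power_mult_distrib)
    finally have "(24 * real n) powr (3 / 2) \<le> 24 * W"
      by (rule power2_le_imp_le) (use W in simp)
    then show ?thesis using W by (simp add: field_simps)
  qed
  ultimately show ?thesis using assms by (intro ratio_inequalityI) auto
qed

lemma ratio_inequality_large:
  assumes n: "800 \<le> n"
  shows "real (partition_count (n - 1)) / real (partition_count n) * (1 + 240 / (24 * real n) powr (3 / 2))
    > real (partition_count n) / real (partition_count (n + 1))"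
proof -
  obtain t where t: "0 < t" "mean_size t = real n"
    using mean_size_surj[of "real n"] n by auto
  have nt: "real n * t\<^sup>2 \<le> 329 / 200"
    using mean_size_le[OF t(1)] t by (simp add: field_simps)
  \<comment> \<open>This fixes the cutoff 800: 329/160000 <= 1/484.\<close>
  have "800 * t\<^sup>2 \<le> real n * t\<^sup>2" using n by (intro mult_right_mono) auto
  then have "t\<^sup>2 \<le> (1 / 22)\<^sup>2" using nt by (simp add: power_divide)
  then have t22: "t \<le> 1 / 22" by (rule power2_le_imp_le) simp
  define r where "r = exp (- t)"
  define E where "E = exp (Re (log_gf (of_real (exp (- t)))))"
  define I where "I N = pi * real (partition_count N) * r ^ N / E" for N
  have I: "((\<lambda>\<theta>. exp (- total_damping t \<theta>) * cos (total_phase t \<theta> + (real n - real N) * \<theta>))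
     has_integral I N) {0..pi}" for N
    using partition_count_saddle_integral[OF t(1), of N] by (simp add: I_def r_def E_def t(2))
  have pos: "0 < I N" for N
    using partition_count_pos by (simp add: I_def r_def E_def)
  have "(I n)\<^sup>2 < (1 + 967 / 1000 * t ^ 3) * (I (n - 1) * I (n + 1))"
    using I[of n] I[of "n - 1"] I[of "n + 1"] n
    by (intro saddle_integrals_log_concavity t t22 pos) (simp_all add: of_nat_diff)
  define F where "F = (pi / E)\<^sup>2 * r ^ (2 * n)"
  have F: "0 < F" by (simp add: F_def E_def r_def)
  have "(I n)\<^sup>2 = F * real (partition_count n) ^ 2"
    by (simp add: I_def F_def power_mult_distrib power_divide mult.commute flip: power_mult)
  moreover have "I (n - 1) * I (n + 1)
      = F * (real (partition_count (n - 1)) * real (partition_count (n + 1)))"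
  proof -
    have "r ^ (n - 1) * r ^ (n + 1) = r ^ (2 * n)"
    proof -
      have "(n - 1) + (n + 1) = 2 * n" using n by simp
      then show ?thesis by (simp only: power_add[symmetric])
    qed
    then show ?thesis by (simp add: I_def F_def power2_eq_square)
  qed
  ultimately have "F * real (partition_count n) ^ 2
      < F * (real (partition_count (n - 1)) * real (partition_count (n + 1)) * (1 + 967 / 1000 * t ^ 3))"
    using \<open>(I n)\<^sup>2 < _\<close> by (simp add: mult_ac)
  then have "real (partition_count n) ^ 2
      < real (partition_count (n - 1)) * real (partition_count (n + 1)) * (1 + 967 / 1000 * t ^ 3)"
    using F by (simp only: mult_less_cancel_left_pos)
  \<comment> \<open>967/1000 is 240 / (24 * 329/200)^(3/2) rounded down to three digits.\<close>
  moreover have "967 / 1000 * t ^ 3 * (24 * real n) powr (3 / 2) \<le> 240"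
  proof (rule power2_le_imp_le)
    have "(967 / 1000 * t ^ 3 * (24 * real n) powr (3 / 2))\<^sup>2 = (967 / 1000)\<^sup>2 * 13824 * (real n * t\<^sup>2) ^ 3"
      by (simp add: power_mult_distrib powr_three_halves_square power_divide flip: power_mult)
    also have "\<dots> \<le> (967 / 1000)\<^sup>2 * 13824 * (329 / 200) ^ 3"
      using nt by (intro mult_left_mono power_mono) auto
    also have "\<dots> \<le> 240\<^sup>2" by (simp add: power_divide)
    finally show "(967 / 1000 * t ^ 3 * (24 * real n) powr (3 / 2))\<^sup>2 \<le> 240\<^sup>2" .
  qed simp
  ultimately show ?thesis using n by (intro ratio_inequalityI) auto
qed

theorem theorem4p2:
  fixes n :: nat
  assumes "n > 6"
  shows "real (partition_count (n - 1)) / real (partition_count n)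
           * (1 + 240 / (24 * real n) powr (3/2))
         > real (partition_count n) / real (partition_count (n + 1))"
  using assms ratio_inequality_small[of n] ratio_inequality_large[of n] by (cases "n < 800") auto

end
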